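(* Let $\{\mathbf{W}_j\}_{j\in T_2}\subset \ell^2(\Lambda,\mathbb{C}^S)$. Then $\mathcal{G}(\Lambda,T_1,T_2,\mathbf{W}_j)$ is a DVNUG Bessel sequence if and only if there exists a constant $C_0<\infty$ such that for a.e. $\xi\in\Omega$ and all $m\in T_1$, $j\in T_2$, $$\big\|\mathcal{F}(E_{\frac{m}{M}}\mathbf{W}_j)(\xi)\big\|_{\mathbb{C}^S}\le C_0.$$
   Context: Standing setting: $N,M,S\in\mathbb{N}$ (positive integers), $P\in\mathbb{N}\cup\{0\}$, $r$ is an odd integer coprime with $N$ with $1\le r\le 2N-1$, $\Lambda=\{0,\frac{r}{N}\}+2\mathbb{Z}$, $\Omega=[0,\frac12)\cup[\frac N2,\frac{N+1}{2})$, $T_1=\{0,1,\dots,M-1\}$, $T_2=\{0,1,\dots,P\}$. For $\mathbf{X}\in\mathbb{C}^S$, $[\mathbf{X}]_k$ is its $k$-th coordinate and $\|\mathbf{X}\|_{\mathbb{C}^S}=(\sum_{k=1}^S|[\mathbf{X}]_k|^2)^{1/2}$. $\ell^2(\Lambda,\mathbb{C}^S)$ is the Hilbert space of families $\mathbf{Z}=\{\mathbf{Z}(\lambda)\}_{\lambda\in\Lambda}\subset\mathbb{C}^S$ with $\sum_{\lambda\in\Lambda}\sum_{k=1}^S|[\mathbf{Z}(\lambda)]_k|^2<\infty$, with inner product $\langle\mathbf{Z},\mathbf{W}\rangle=\sum_{\lambda\in\Lambda}\sum_{k=1}^S[\mathbf{Z}(\lambda)]_k\overline{[\mathbf{W}(\lambda)]_k}$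 and induced norm $\|\cdot\|_{\ell^2}$. Operators on $\ell^2(\Lambda,\mathbb{C}^S)$: for $\lambda\in\Lambda$, $(R_{2N\lambda}\mathbf{Z})(\lambda')=\mathbf{Z}(\lambda'-2N\lambda)$, $\lambda'\in\Lambda$ (well defined since $2N\Lambda\subset 2\mathbb{Z}$); for $m\in T_1$, $(E_{\frac mM}\mathbf{Z})(\lambda')=e^{2\pi i\frac mM\lambda'}\mathbf{Z}(\lambda')$, $\lambda'\in\Lambda$. Fourier transform: $\mathcal{F}:\ell^2(\Lambda,\mathbb{C}^S)\to L^2(\Omega,\mathbb{C}^S)$, $[\mathcal{F}(\mathbf{Z})(\xi)]_k=\sum_{\lambda\in\Lambda}[\mathbf{Z}(\lambda)]_k e^{2\pi i\lambda\xi}$, $1\le k\le S$ (series convergent in $L^2(\Omega)$). $\mathcal{G}(\Lambda,T_1,T_2,\mathbf{W}_j)$ denotes the collection $\{E_{\frac mM}R_{2N\lambda}\mathbf{W}_j:\lambda\in\Lambda,\,m\in T_1,\,j\in T_2\}$ (the discrete vector-valued nonuniform Gabor system, DVNUG system, with window sequences $\mathbf{W}_j$). It is a DVNUG Bessel sequence if there is a finite constant $\beta>0$ (a Bessel bound) such that $\sum_{m\in T_1,\,j\in T_2,\,\lambda\in\Lambda}|\langle\mathbf{Z},E_{\frac mM}R_{2N\lambda}\mathbf{W}_j\rangle|^2\le\beta\|\mathbf{Z}\|_{\ell^2}^2$ for all $\mathbf{Z}\in\ell^2(\Lambda,\mathbb{C}^S)$. *)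

theory Defs
  imports "HOL-Analysis.Analysis"
begin

definition T1 :: "nat \<Rightarrow> nat set" where
  "T1 M = {0..<M}"

definition T2 :: "nat \<Rightarrow> nat set" where
  "T2 P = {0..P}"

definition Lam :: "nat \<Rightarrow> nat \<Rightarrow> real set" where
  "Lam N r = {c + 2 * of_int n | c (n::int). c \<in> {0, real r / real N}}"

definition Omega :: "nat \<Rightarrow> real set" where
  "Omega N = {0..<1/2} \<union> {real N / 2..<(real N + 1) / 2}"

text \<open>A family indexed by \<open>L\<close> is a function on the reals that vanishes off \<open>L\<close>.  The space
  \<open>\<complex>\<^sup>S\<close> is \<^typ>\<open>complex^'s\<close> with \<open>S = CARD('s)\<close>; its library norm is the Euclidean one.\<close>

definition l2 :: "real set \<Rightarrow> (real \<Rightarrow> complex^'s) set" where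
  "l2 L = {Z. (\<forall>x. x \<notin> L \<longrightarrow> Z x = 0) \<and>
              (\<lambda>x. \<Sum>k\<in>UNIV. (cmod (Z x $ k))\<^sup>2) summable_on L}"

definition l2_inner :: "real set \<Rightarrow> (real \<Rightarrow> complex^'s) \<Rightarrow> (real \<Rightarrow> complex^'s) \<Rightarrow> complex" where
  "l2_inner L Z W = (\<Sum>\<^sub>\<infinity>x\<in>L. \<Sum>k\<in>UNIV. Z x $ k * cnj (W x $ k))"

definition l2_norm :: "real set \<Rightarrow> (real \<Rightarrow> complex^'s) \<Rightarrow> real" where
  "l2_norm L Z = sqrt (Re (l2_inner L Z Z))"

text \<open>When \<open>L = Lam N r\<close> and \<open>a \<in> 2 \<int>\<close>, translation by \<open>a\<close> maps \<open>L\<close> and its complement to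
  themselves, so \<open>transl a\<close> acts on \<open>l2 L\<close>.\<close>

definition transl :: "real \<Rightarrow> (real \<Rightarrow> complex^'s) \<Rightarrow> real \<Rightarrow> complex^'s" where
  "transl a Z = (\<lambda>x. Z (x - a))"

definition modul :: "real \<Rightarrow> (real \<Rightarrow> complex^'s) \<Rightarrow> real \<Rightarrow> complex^'s" where
  "modul b Z = (\<lambda>x. cis (2 * pi * b * x) *s Z x)"

text \<open>\<open>f\<close> represents the Fourier transform of \<open>Z\<close> if it is in \<open>L\<^sup>2(D)\<close> and each coordinate is
  the (unconditional) \<open>L\<^sup>2(D)\<close> sum of the corresponding exponential series.\<close>

definition is_fourier ::
    "real set \<Rightarrow> real set \<Rightarrow> (real \<Rightarrow> complex^'s) \<Rightarrow> (real \<Rightarrow> complex^'s) \<Rightarrow> bool" where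
  "is_fourier L D Z f \<longleftrightarrow>
     (\<forall>k. (\<lambda>\<xi>. f \<xi> $ k) \<in> borel_measurable (lebesgue_on D) \<and>
          integrable (lebesgue_on D) (\<lambda>\<xi>. (cmod (f \<xi> $ k))\<^sup>2) \<and>
          ((\<lambda>A. \<integral>\<xi>. (cmod (f \<xi> $ k - (\<Sum>x\<in>A. Z x $ k * cis (2 * pi * x * \<xi>))))\<^sup>2
                  \<partial>lebesgue_on D) \<longlongrightarrow> 0) (finite_subsets_at_top L))"

text \<open>An arbitrary representative: \<^const>\<open>is_fourier\<close> determines \<open>f\<close> up to a null set, and for
  \<open>Z \<in> l2 (Lam N r)\<close>, \<open>D = Omega N\<close> such an \<open>f\<close> exists because the exponentials with
  frequencies in \<open>Lam N r\<close> are orthonormal in \<open>L\<^sup>2(D)\<close> when \<open>r\<close> is odd.\<close>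

definition fourier ::
    "real set \<Rightarrow> real set \<Rightarrow> (real \<Rightarrow> complex^'s) \<Rightarrow> real \<Rightarrow> complex^'s" where
  "fourier L D Z = (SOME f. is_fourier L D Z f)"

definition DVNUG ::
    "nat \<Rightarrow> nat \<Rightarrow> (nat \<Rightarrow> real \<Rightarrow> complex^'s) \<Rightarrow> nat \<times> nat \<times> real \<Rightarrow> real \<Rightarrow> complex^'s" where
  "DVNUG N M W = (\<lambda>(m, j, l). modul (real m / real M) (transl (2 * real N * l) (W j)))"

text \<open>Summability is required explicitly since \<^const>\<open>infsum\<close> is 0 on divergent sums.\<close>

definition DVNUG_bessel ::
    "nat \<Rightarrow> nat \<Rightarrow> nat \<Rightarrow> nat \<Rightarrow> (nat \<Rightarrow> real \<Rightarrow> complex^'s) \<Rightarrow> bool" where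
  "DVNUG_bessel N r M P W \<longleftrightarrow>
     (\<exists>\<beta>::real. \<beta> > 0 \<and> (\<forall>Z \<in> l2 (Lam N r).
        (\<lambda>i. (cmod (l2_inner (Lam N r) Z (DVNUG N M W i)))\<^sup>2)
            summable_on (T1 M \<times> T2 P \<times> Lam N r) \<and>
        (\<Sum>\<^sub>\<infinity>i \<in> T1 M \<times> T2 P \<times> Lam N r. (cmod (l2_inner (Lam N r) Z (DVNUG N M W i)))\<^sup>2)
            \<le> \<beta> * (l2_norm (Lam N r) Z)\<^sup>2))"

end

theory Submission
  imports Defs
begin

text \<open>
  Write \<open>V = E\<^bsub>m/M\<^esub> W\<^sub>j\<close> and \<open>v\<close> for its Fourier transform.  A modulation and a translation commute up
  to a unimodular factor, so the system consists of the translates of the \<open>V\<close> by \<open>2N\<Lambda> \<subseteq> 2\<int>\<close>.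
  By duality, a Bessel bound for these translates is the same as a bound for the synthesis operator
  \<open>c \<mapsto> Y = \<Sum> c\<^sub>a R\<^sub>a V\<close>.  The Fourier transform of \<open>Y\<close> is \<open>p v\<close> with
  \<open>p(\<xi>) = \<Sum> c\<^sub>a exp (2\<pi>ia\<xi>)\<close>, and \<open>2\<int> \<subseteq> \<Lambda>\<close>, so Parseval turns the bound for \<open>Y\<close> into
  \<open>\<integral> \<bar>p\<bar>\<^sup>2 \<parallel>v\<parallel>\<^sup>2 \<le> \<beta> \<integral> \<bar>p\<bar>\<^sup>2\<close> over \<open>\<Omega>\<close>.
  If \<open>v\<close> is essentially bounded this is clear.  Conversely, for frequencies in \<open>4N\<int>\<close>, approximation
  by Stone--Weierstrass replaces \<open>\<bar>p\<bar>\<^sup>2\<close> by the indicator of a closed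
  \<open>1/4N\<close>-periodic set; taking the periodisation of a compact subset of \<open>{\<parallel>v\<parallel>\<^sup>2 > K\<beta>}\<close>, where \<open>K\<close>
  bounds the number of its translates that meet \<open>\<Omega>\<close>, shows that this set is null.
\<close>

section \<open>Orthonormal expansions in mean square\<close>

text \<open>The parameter \<open>t\<close> is kept free so that the weight on the first term can be
  pushed towards 1. Integrated, the inequality takes over the role of the triangle inequality in
  mean square.\<close>

lemma cmod_add_power2_le:
  fixes a b :: complex and t :: real
  assumes "t > 0"
  shows "(cmod (a + b))\<^sup>2 \<le> (1 + t) * (cmod a)\<^sup>2 + (1 + 1 / t) * (cmod b)\<^sup>2"
proof -
  have "0 \<le> (t * cmod a - cmod b)\<^sup>2 / t" using assms by simp
  also have "\<dots> = t * (cmod a)\<^sup>2 + (1 / t) * (cmod b)\<^sup>2 - 2 * cmod a * cmod b"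
    using assms by (simp add: power2_eq_square field_simps)
  finally have "2 * cmod a * cmod b \<le> t * (cmod a)\<^sup>2 + (1 / t) * (cmod b)\<^sup>2" by simp
  moreover have "(cmod (a + b))\<^sup>2 \<le> (cmod a + cmod b)\<^sup>2"
    by (intro power_mono norm_triangle_ineq) simp
  ultimately show ?thesis by (simp add: power2_sum algebra_simps)
qed

lemma cmod_add_power2_le_2: "(cmod (a + b))\<^sup>2 \<le> 2 * (cmod a)\<^sup>2 + 2 * (cmod b)\<^sup>2"
  using cmod_add_power2_le[of 1 a b] by simp

text \<open>Unimodular functions on a finite measure space have bounded finite combinations, so
  every partial sum is square integrable. The intended instance is the exponentials with frequencies
  in \<open>Lam N r\<close> on \<open>Omega N\<close>.\<close>

locale unimodular_orthonormal = finite_measure M for M :: "'a measure" +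
  fixes e :: "'i \<Rightarrow> 'a \<Rightarrow> complex" and L :: "'i set"
  assumes e_measurable [measurable]: "e x \<in> borel_measurable M"
    and norm_e [simp]: "cmod (e x t) = 1"
    and e_orthonormal: "x \<in> L \<Longrightarrow> y \<in> L \<Longrightarrow> (\<integral>t. e x t * cnj (e y t) \<partial>M) = of_bool (x = y)"
begin

definition psum :: "('i \<Rightarrow> complex) \<Rightarrow> 'i set \<Rightarrow> 'a \<Rightarrow> complex" where
  "psum u A t = (\<Sum>x\<in>A. u x * e x t)"

text \<open>This is one coordinate of \<open>is_fourier\<close>, stated for a general orthonormal
  family, so that scalar results carry over coordinate by coordinate.\<close>

definition expands :: "('i \<Rightarrow> complex) \<Rightarrow> ('a \<Rightarrow> complex) \<Rightarrow> bool" where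
  "expands u f \<longleftrightarrow> f \<in> borel_measurable M \<and> integrable M (\<lambda>t. (cmod (f t))\<^sup>2) \<and>
     ((\<lambda>A. \<integral>t. (cmod (f t - psum u A t))\<^sup>2 \<partial>M) \<longlongrightarrow> 0) (finite_subsets_at_top L)"

lemma psum_measurable [measurable]: "psum u A \<in> borel_measurable M"
  unfolding psum_def by measurable

lemma integrable_psum_power2: "integrable M (\<lambda>t. (cmod (psum u A t))\<^sup>2)"
proof (rule integrable_const_bound)
  show "AE t in M. norm ((cmod (psum u A t))\<^sup>2) \<le> (\<Sum>x\<in>A. cmod (u x))\<^sup>2"
  proof (rule AE_I2)
    fix t
    have "cmod (psum u A t) \<le> (\<Sum>x\<in>A. cmod (u x))"
      unfolding psum_def by (rule order_trans[OF norm_sum]) (simp add: norm_mult)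
    then show "norm ((cmod (psum u A t))\<^sup>2) \<le> (\<Sum>x\<in>A. cmod (u x))\<^sup>2"
      by (simp add: power_mono)
  qed
qed measurable

lemma integral_psum_power2:
  assumes "finite A" "A \<subseteq> L"
  shows "(\<integral>t. (cmod (psum u A t))\<^sup>2 \<partial>M) = (\<Sum>x\<in>A. (cmod (u x))\<^sup>2)"
proof -
  have int: "integrable M (\<lambda>t. e x t * cnj (e y t))" for x y
  proof (rule integrable_const_bound[where B = 1])
    have "cnj \<in> borel_measurable borel"
      by (intro borel_measurable_continuous_onI continuous_intros)
    from measurable_compose[OF e_measurable this]
    show "(\<lambda>t. e x t * cnj (e y t)) \<in> borel_measurable M" by measurable
  qed (simp add: norm_mult)
  have "complex_of_real (\<integral>t. (cmod (psum u A t))\<^sup>2 \<partial>M)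
      = (\<integral>t. complex_of_real ((cmod (psum u A t))\<^sup>2) \<partial>M)"
    by (rule integral_complex_of_real[symmetric])
  also have "\<dots> = (\<integral>t. (\<Sum>x\<in>A. \<Sum>y\<in>A. (u x * cnj (u y)) * (e x t * cnj (e y t))) \<partial>M)"
    unfolding complex_norm_square psum_def
    by (simp add: sum_product cnj_sum mult_ac)
  also have "\<dots> = (\<Sum>x\<in>A. \<Sum>y\<in>A. (u x * cnj (u y)) * (\<integral>t. e x t * cnj (e y t) \<partial>M))"
    using int by simp
  also have "\<dots> = (\<Sum>x\<in>A. \<Sum>y\<in>A. (u x * cnj (u y)) * of_bool (x = y))"
    using assms(2) by (intro sum.cong refl) (auto simp: e_orthonormal subset_iff)
  also have "\<dots> = (\<Sum>x\<in>A. u x * cnj (u x))"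
    using assms(1) by (simp add: of_bool_def if_distrib cong: if_cong)
  also have "\<dots> = complex_of_real (\<Sum>x\<in>A. (cmod (u x))\<^sup>2)"
    by (simp add: complex_norm_square[symmetric])
  finally show ?thesis unfolding of_real_eq_iff .
qed

lemma integrable_add_power2:
  assumes [measurable]: "f \<in> borel_measurable M" "g \<in> borel_measurable M"
    and "integrable M (\<lambda>t. (cmod (f t))\<^sup>2)" "integrable M (\<lambda>t. (cmod (g t))\<^sup>2)"
  shows "integrable M (\<lambda>t. (cmod (f t + g t))\<^sup>2)"
proof (rule Bochner_Integration.integrable_bound)
  show "integrable M (\<lambda>t. 2 * (cmod (f t))\<^sup>2 + 2 * (cmod (g t))\<^sup>2)" using assms by simp
qed (use cmod_add_power2_le_2 in auto)

lemma integrable_diff_power2: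
  assumes "f \<in> borel_measurable M" "g \<in> borel_measurable M"
    and "integrable M (\<lambda>t. (cmod (f t))\<^sup>2)" "integrable M (\<lambda>t. (cmod (g t))\<^sup>2)"
  shows "integrable M (\<lambda>t. (cmod (f t - g t))\<^sup>2)"
  using integrable_add_power2[of f "\<lambda>t. - g t"] assms by simp

lemma integral_add_power2_le:
  assumes [measurable]: "f \<in> borel_measurable M" "g \<in> borel_measurable M"
    and "integrable M (\<lambda>t. (cmod (f t))\<^sup>2)" "integrable M (\<lambda>t. (cmod (g t))\<^sup>2)" and "c > 0"
  shows "(\<integral>t. (cmod (f t + g t))\<^sup>2 \<partial>M)
     \<le> (1 + c) * (\<integral>t. (cmod (f t))\<^sup>2 \<partial>M) + (1 + 1 / c) * (\<integral>t. (cmod (g t))\<^sup>2 \<partial>M)"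
proof -
  have "(\<integral>t. (cmod (f t + g t))\<^sup>2 \<partial>M)
     \<le> (\<integral>t. (1 + c) * (cmod (f t))\<^sup>2 + (1 + 1 / c) * (cmod (g t))\<^sup>2 \<partial>M)"
    by (rule integral_mono) (use assms integrable_add_power2 cmod_add_power2_le in auto)
  also have "\<dots> = (1 + c) * (\<integral>t. (cmod (f t))\<^sup>2 \<partial>M) + (1 + 1 / c) * (\<integral>t. (cmod (g t))\<^sup>2 \<partial>M)"
    using assms by simp
  finally show ?thesis .
qed

text \<open>Writing the partial sum as \<open>f\<close> minus the error, and \<open>f\<close> as the
  partial sum plus the error, bounds \<open>s A\<close> and \<open>I\<close> by each other up to a
  factor \<open>1 + c\<close> and a multiple of the error \<open>d A\<close>. For fixed
  \<open>c\<close> the error vanishes along the finite subsets. Given a strict bound on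
  \<open>I\<close>, a \<open>c\<close> close enough to 0 leaves room for it, which yields the limit
  of \<open>s\<close>.\<close>

lemma expands_parseval:
  assumes "expands u f"
  shows "((\<lambda>x. (cmod (u x))\<^sup>2) has_sum (\<integral>t. (cmod (f t))\<^sup>2 \<partial>M)) L"
proof -
  let ?F = "finite_subsets_at_top L"
  define I where "I = (\<integral>t. (cmod (f t))\<^sup>2 \<partial>M)"
  define s where "s = sum (\<lambda>x. (cmod (u x))\<^sup>2)"
  define d where "d A = (\<integral>t. (cmod (f t - psum u A t))\<^sup>2 \<partial>M)" for A
  have [measurable]: "f \<in> borel_measurable M" and int: "integrable M (\<lambda>t. (cmod (f t))\<^sup>2)"
    and d0: "(d \<longlongrightarrow> 0) ?F"
    using assms unfolding expands_def d_def by auto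
  have intd: "integrable M (\<lambda>t. (cmod (f t - psum u A t))\<^sup>2)" for A
    by (rule integrable_diff_power2) (use int integrable_psum_power2 in auto)
  have ev: "\<forall>\<^sub>F A in ?F. finite A \<and> A \<subseteq> L"
    by (rule eventually_finite_subsets_at_top_weakI) auto
  have upper: "s A \<le> (1 + c) * I + (1 + 1 / c) * d A" if "finite A" "A \<subseteq> L" "c > 0" for A c
  proof -
    have "s A = (\<integral>t. (cmod (f t + - (f t - psum u A t)))\<^sup>2 \<partial>M)"
      using integral_psum_power2[OF that(1,2)] by (simp add: s_def)
    also have "\<dots> \<le> (1 + c) * I + (1 + 1 / c) * (\<integral>t. (cmod (- (f t - psum u A t)))\<^sup>2 \<partial>M)"
      unfolding I_def by (rule integral_add_power2_le) (use that int intd in \<open>auto simp: norm_minus_commute\<close>)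
    finally show ?thesis unfolding d_def norm_minus_cancel .
  qed
  have lower: "I \<le> (1 + c) * s A + (1 + 1 / c) * d A" if "finite A" "A \<subseteq> L" "c > 0" for A c
  proof -
    have "I = (\<integral>t. (cmod (psum u A t + (f t - psum u A t)))\<^sup>2 \<partial>M)"
      by (simp add: I_def)
    also have "\<dots> \<le> (1 + c) * (\<integral>t. (cmod (psum u A t))\<^sup>2 \<partial>M) + (1 + 1 / c) * (\<integral>t. (cmod (f t - psum u A t))\<^sup>2 \<partial>M)"
      by (rule integral_add_power2_le) (use that intd integrable_psum_power2 in auto)
    finally show ?thesis using integral_psum_power2[OF that(1,2)] by (simp add: d_def s_def)
  qed
  have I0: "I \<ge> 0" unfolding I_def by simp
  have lim: "((\<lambda>A. (1 + c) * I + (1 + 1 / c) * d A) \<longlongrightarrow> (1 + c) * I) ?F"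
    "((\<lambda>A. (I - (1 + 1 / c) * d A) / (1 + c)) \<longlongrightarrow> I / (1 + c)) ?F" if "c > 0" for c :: real
    using that by (auto intro!: tendsto_eq_intros d0)
  have "(s \<longlongrightarrow> I) ?F"
  proof (rule order_tendstoI)
    fix a assume "a < I"
    have "((\<lambda>c. I / (1 + c)) \<longlongrightarrow> I / (1 + 0)) (at_right 0)" by (intro tendsto_intros) auto
    then have "\<forall>\<^sub>F c in at_right 0. a < I / (1 + c) \<and> c > 0"
      using \<open>a < I\<close> by (intro eventually_conj order_tendstoD(1)[of _ I] eventually_at_right_less) simp_all
    then obtain c where c: "a < I / (1 + c)" "c > 0"
      using eventually_happens'[OF trivial_limit_at_right_real] by blast
    show "\<forall>\<^sub>F A in ?F. a < s A"
      using order_tendstoD(1)[OF lim(2)[OF c(2)] c(1)] ev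
    proof eventually_elim
      case (elim A)
      then have "(I - (1 + 1 / c) * d A) / (1 + c) \<le> s A"
        using lower[of A c] c(2) by (simp add: pos_divide_le_eq mult.commute)
      with elim show ?case by simp
    qed
  next
    fix a assume "I < a"
    have "((\<lambda>c. (1 + c) * I) \<longlongrightarrow> (1 + 0) * I) (at_right 0)" by (intro tendsto_intros)
    then have "\<forall>\<^sub>F c in at_right 0. (1 + c) * I < a \<and> c > 0"
      using \<open>I < a\<close> by (intro eventually_conj order_tendstoD(2)[of _ I] eventually_at_right_less) simp_all
    then obtain c where c: "(1 + c) * I < a" "c > 0"
      using eventually_happens'[OF trivial_limit_at_right_real] by blast
    show "\<forall>\<^sub>F A in ?F. s A < a"
      using order_tendstoD(2)[OF lim(1)[OF c(2)] c(1)] ev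
      by eventually_elim (use upper c(2) in \<open>meson le_less_trans\<close>)
  qed
  then show ?thesis by (simp add: has_sum_def s_def I_def)
qed

lemma expands_cmult:
  assumes "expands u f" shows "expands (\<lambda>x. c * u x) (\<lambda>t. c * f t)"
proof -
  have [measurable]: "f \<in> borel_measurable M" using assms by (simp add: expands_def)
  have eq: "(cmod (c * f t - psum (\<lambda>x. c * u x) A t))\<^sup>2 = (cmod c)\<^sup>2 * (cmod (f t - psum u A t))\<^sup>2" for A t
    by (simp add: psum_def mult.assoc flip: norm_mult power_mult_distrib sum_distrib_left right_diff_distrib)
  have "((\<lambda>A. (cmod c)\<^sup>2 * (\<integral>t. (cmod (f t - psum u A t))\<^sup>2 \<partial>M)) \<longlongrightarrow> (cmod c)\<^sup>2 * 0) (finite_subsets_at_top L)"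
    by (intro tendsto_intros) (use assms in \<open>simp add: expands_def\<close>)
  then show ?thesis using assms unfolding expands_def eq by (simp add: norm_mult power_mult_distrib)
qed

lemma expands_add:
  assumes "expands u f" "expands v g" shows "expands (\<lambda>x. u x + v x) (\<lambda>t. f t + g t)"
proof -
  let ?F = "finite_subsets_at_top L"
  have [measurable]: "f \<in> borel_measurable M" "g \<in> borel_measurable M"
    and int: "integrable M (\<lambda>t. (cmod (f t))\<^sup>2)" "integrable M (\<lambda>t. (cmod (g t))\<^sup>2)"
    using assms by (auto simp add: expands_def)
  have int': "integrable M (\<lambda>t. (cmod (f t - psum u A t))\<^sup>2)" "integrable M (\<lambda>t. (cmod (g t - psum v A t))\<^sup>2)" for A
    by (rule integrable_diff_power2; use int integrable_psum_power2 in auto)+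
  have eq: "f t + g t - psum (\<lambda>x. u x + v x) A t = (f t - psum u A t) + (g t - psum v A t)" for A t
    by (simp add: psum_def algebra_simps sum.distrib)
  have "((\<lambda>A. (1 + 1) * (\<integral>t. (cmod (f t - psum u A t))\<^sup>2 \<partial>M)
       + (1 + 1 / 1) * (\<integral>t. (cmod (g t - psum v A t))\<^sup>2 \<partial>M)) \<longlongrightarrow> (1 + 1) * 0 + (1 + 1 / 1) * 0) ?F"
    by (intro tendsto_intros) (use assms in \<open>simp_all add: expands_def\<close>)
  then have lim: "((\<lambda>A. (1 + 1) * (\<integral>t. (cmod (f t - psum u A t))\<^sup>2 \<partial>M)
       + (1 + 1 / 1) * (\<integral>t. (cmod (g t - psum v A t))\<^sup>2 \<partial>M)) \<longlongrightarrow> 0) ?F"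
    by simp
  have "((\<lambda>A. \<integral>t. (cmod (f t + g t - psum (\<lambda>x. u x + v x) A t))\<^sup>2 \<partial>M) \<longlongrightarrow> 0) ?F"
  proof (rule tendsto_sandwich[OF _ _ tendsto_const lim])
    show "\<forall>\<^sub>F A in ?F. (\<integral>t. (cmod (f t + g t - psum (\<lambda>x. u x + v x) A t))\<^sup>2 \<partial>M)
       \<le> (1 + 1) * (\<integral>t. (cmod (f t - psum u A t))\<^sup>2 \<partial>M)
       + (1 + 1 / 1) * (\<integral>t. (cmod (g t - psum v A t))\<^sup>2 \<partial>M)"
      unfolding eq by (intro always_eventually allI integral_add_power2_le int') auto
  qed auto
  then show ?thesis unfolding expands_def using integrable_add_power2 int by auto
qed

lemma expands_zero: "expands (\<lambda>x. 0) (\<lambda>t. 0)"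
  by (simp add: expands_def psum_def)

lemma expands_sum:
  assumes "\<And>a. a \<in> F \<Longrightarrow> expands (u a) (f a)"
  shows "expands (\<lambda>x. \<Sum>a\<in>F. u a x) (\<lambda>t. \<Sum>a\<in>F. f a t)"
  using assms by (induction F rule: infinite_finite_induct) (auto simp: expands_zero expands_add)

text \<open>Terms common to both sets cancel. What remains is a single partial sum over the
  symmetric difference, with coefficients negated on \<open>B - A\<close>, and the norm formula for
  partial sums applies to it.\<close>

lemma integral_psum_diff_power2:
  assumes "finite A" "A \<subseteq> L" "finite B" "B \<subseteq> L"
  shows "(\<integral>t. (cmod (psum u A t - psum u B t))\<^sup>2 \<partial>M)
    = (\<Sum>x\<in>A - B. (cmod (u x))\<^sup>2) + (\<Sum>x\<in>B - A. (cmod (u x))\<^sup>2)"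
proof -
  define w where "w x = (if x \<in> A then u x else - u x)" for x
  have "psum u A t - psum u B t = psum w ((A - B) \<union> (B - A)) t" for t
  proof -
    have "psum u A t = psum u (A - B) t + psum u (A \<inter> B) t"
      unfolding psum_def using sum.Int_Diff[OF assms(1), of _ B] by (simp add: add.commute)
    moreover have "psum u B t = psum u (B - A) t + psum u (A \<inter> B) t"
      unfolding psum_def using sum.Int_Diff[OF assms(3), of _ A] by (simp add: add.commute Int_commute)
    moreover have "psum w ((A - B) \<union> (B - A)) t = psum u (A - B) t - psum u (B - A) t"
      unfolding psum_def using assms
      by (subst sum.union_disjoint) (auto simp: w_def sum_negf[symmetric] intro!: arg_cong2[where f = "(+)"] sum.cong)
    ultimately show ?thesis by simp
  qed
  then have "(\<integral>t. (cmod (psum u A t - psum u B t))\<^sup>2 \<partial>M) = (\<Sum>x\<in>(A - B) \<union> (B - A). (cmod (w x))\<^sup>2)"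
    using integral_psum_power2[of "(A - B) \<union> (B - A)" w] assms by auto
  also have "\<dots> = (\<Sum>x\<in>A - B. (cmod (w x))\<^sup>2) + (\<Sum>x\<in>B - A. (cmod (w x))\<^sup>2)"
    using assms by (intro sum.union_disjoint) auto
  also have "\<dots> = (\<Sum>x\<in>A - B. (cmod (u x))\<^sup>2) + (\<Sum>x\<in>B - A. (cmod (u x))\<^sup>2)"
    by (intro arg_cong2[where f = "(+)"] sum.cong) (auto simp: w_def)
  finally show ?thesis .
qed

text \<open>Riesz--Fischer: the partial sums over suitable finite sets converge almost everywhere, and
  Fatou's lemma identifies the pointwise limit with the mean-square limit.\<close>

lemma expands_exists:
  assumes "(\<lambda>x. (cmod (u x))\<^sup>2) summable_on L"
  shows "\<exists>f. expands u f"
proof -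
  let ?F = "finite_subsets_at_top L"
  define s where "s A = (\<Sum>x\<in>A. (cmod (u x))\<^sup>2)" for A
  define S where "S = infsum (\<lambda>x. (cmod (u x))\<^sup>2) L"
  have sS: "(s \<longlongrightarrow> S) ?F"
    unfolding s_def S_def using infsum_tendsto[OF assms] by simp
  have s_le: "s A \<le> S" if "finite A" "A \<subseteq> L" for A
    unfolding s_def S_def by (rule finite_sum_le_infsum) (use assms that in auto)
  \<comment> \<open>Tails below \<open>(1/4) ^ n\<close> make the mean-square distance of
    consecutive partial sums of order \<open>(1/2) ^ n\<close>, which is summable. This is the usual
    fast subsequence of a Cauchy sequence.\<close>
  have "\<exists>A. finite A \<and> A \<subseteq> L \<and> S - s A \<le> (1/4) ^ n" for n
  proof -
    have "\<forall>\<^sub>F A in ?F. S - (1/4) ^ n < s A \<and> finite A \<and> A \<subseteq> L"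
      by (intro eventually_conj order_tendstoD(1)[OF sS] eventually_finite_subsets_at_top_weakI) auto
    from eventually_happens'[OF finite_subsets_at_top_neq_bot this] show ?thesis by force
  qed
  then obtain A where A: "\<And>n. finite (A n)" "\<And>n. A n \<subseteq> L" "\<And>n. S - s (A n) \<le> (1/4) ^ n"
    by metis
  have tail: "s (B - C) \<le> S - s C" if "finite B" "B \<subseteq> L" "finite C" "C \<subseteq> L" for B C
  proof -
    have "s (B \<union> C) = s (B - C) + s C"
      unfolding s_def using that by (subst sum.union_disjoint[symmetric]) (auto intro: sum.cong)
    with s_le[of "B \<union> C"] that show ?thesis by simp
  qed
  have dist: "(\<integral>t. (cmod (psum u (A n) t - psum u B t))\<^sup>2 \<partial>M) \<le> (1/4) ^ n + (S - s B)"
    if "finite B" "B \<subseteq> L" for B n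
    using integral_psum_diff_power2[OF A(1,2) that, of u n] tail[OF A(1,2) that, of n] tail[OF that A(1,2), of n] A(3)[of n]
    by (simp add: s_def)
  have int: "integrable M (\<lambda>t. (cmod (psum u B t - psum u C t))\<^sup>2)" for B C
    by (rule integrable_diff_power2) (auto simp: integrable_psum_power2)
  define d where "d n t = psum u (A (Suc n)) t - psum u (A n) t" for n t
  have d_meas [measurable]: "d n \<in> borel_measurable M" for n unfolding d_def by measurable
  have nn_d: "(\<integral>\<^sup>+t. ennreal (cmod (d n t)) \<partial>M) \<le> ennreal ((1 + measure M (space M)) * (1/2) ^ n)" for n
  proof -
    have int_d: "integrable M (\<lambda>t. (cmod (d n t))\<^sup>2)" unfolding d_def by (rule int)
    \<comment> \<open>A weighted arithmetic-geometric mean inequality passes from the square to the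
      first power, in place of Cauchy-Schwarz. The weight \<open>2 ^ n\<close> is chosen so that the
      integral of the square, of order \<open>(1/4) ^ n\<close>, and the constant term both
      contribute order \<open>(1/2) ^ n\<close>.\<close>
    have "cmod (d n t) \<le> 2 ^ n / 2 * (cmod (d n t))\<^sup>2 + (1/2) ^ n" for t
    proof -
      have "0 \<le> (2 ^ n * cmod (d n t) - 1)\<^sup>2 * (1/2) ^ n / 2" by simp
      also have "\<dots> = 2 ^ n / 2 * (cmod (d n t))\<^sup>2 - cmod (d n t) + (1/2) ^ n / 2"
        by (simp add: power2_eq_square field_simps power_divide)
      finally have "cmod (d n t) \<le> 2 ^ n / 2 * (cmod (d n t))\<^sup>2 + (1/2) ^ n / 2" by simp
      also have "\<dots> \<le> 2 ^ n / 2 * (cmod (d n t))\<^sup>2 + (1/2) ^ n" by simp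
      finally show ?thesis .
    qed
    then have "(\<integral>\<^sup>+t. ennreal (cmod (d n t)) \<partial>M) \<le> (\<integral>\<^sup>+t. ennreal (2 ^ n / 2 * (cmod (d n t))\<^sup>2 + (1/2) ^ n) \<partial>M)"
      by (intro nn_integral_mono ennreal_leI)
    also have "\<dots> = ennreal (\<integral>t. 2 ^ n / 2 * (cmod (d n t))\<^sup>2 + (1/2) ^ n \<partial>M)"
      by (rule nn_integral_eq_integral) (use int_d in auto)
    also have "(\<integral>t. 2 ^ n / 2 * (cmod (d n t))\<^sup>2 + (1/2) ^ n \<partial>M)
        = 2 ^ n / 2 * (\<integral>t. (cmod (d n t))\<^sup>2 \<partial>M) + (1/2) ^ n * measure M (space M)"
      using int_d by simp
    also have "(\<integral>t. (cmod (d n t))\<^sup>2 \<partial>M) \<le> 2 * (1/4) ^ n"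
      using dist[OF A(1,2), of n "Suc n"] A(3)[of "Suc n"] zero_le_power[of "1/4 :: real" n]
      unfolding d_def by (subst norm_minus_commute) (simp del: zero_le_power)
    then have "2 ^ n / 2 * (\<integral>t. (cmod (d n t))\<^sup>2 \<partial>M) + (1/2) ^ n * measure M (space M)
      \<le> 2 ^ n / 2 * (2 * (1/4) ^ n) + (1/2) ^ n * measure M (space M)"
      by (intro add_right_mono mult_left_mono) auto
    also have "2 ^ n / 2 * (2 * (1/4) ^ n) = (1/2 :: real) ^ n"
      by (simp add: flip: power_mult_distrib)
    finally show ?thesis by (simp add: algebra_simps ennreal_leI)
  qed
  have "(\<integral>\<^sup>+t. (\<Sum>n. ennreal (cmod (d n t))) \<partial>M) = (\<Sum>n. \<integral>\<^sup>+t. ennreal (cmod (d n t)) \<partial>M)"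
    by (rule nn_integral_suminf) measurable
  also have "\<dots> \<le> (\<Sum>n. ennreal ((1 + measure M (space M)) * (1/2) ^ n))"
    by (intro suminf_le nn_d) auto
  also have "\<dots> < \<infinity>"
    by (subst suminf_ennreal2) (auto intro!: summable_mult summable_geometric)
  finally have "AE t in M. (\<Sum>n. ennreal (cmod (d n t))) \<noteq> \<infinity>"
    by (intro nn_integral_PInf_AE) auto
  then have conv: "AE t in M. convergent (\<lambda>n. psum u (A n) t)"
  proof eventually_elim
    case (elim t)
    then have "summable (\<lambda>n. cmod (d n t))"
      by (intro summable_suminf_not_top) auto
    then have "summable (\<lambda>n. d n t)" by (rule summable_norm_cancel)
    then have "convergent (\<lambda>n. \<Sum>i<n. d i t)" by (simp add: summable_iff_convergent)
    then have "convergent (\<lambda>n. (\<Sum>i<n. d i t) + psum u (A 0) t)"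
      by (intro convergent_add convergent_const)
    moreover have "(\<Sum>i<n. d i t) + psum u (A 0) t = psum u (A n) t" for n
      unfolding d_def by (subst sum_lessThan_telescope) simp
    ultimately show ?case by simp
  qed
  \<comment> \<open>Where the sequence diverges, \<open>lim\<close> has an unspecified value; this
    happens only on a null set and affects no integral below.\<close>
  define f where "f t = lim (\<lambda>n. psum u (A n) t)" for t
  have f_meas [measurable]: "f \<in> borel_measurable M" unfolding f_def by measurable
  \<comment> \<open>With \<open>B\<close> fixed, letting \<open>n\<close> tend to infinity in
    \<open>dist\<close> removes the term \<open>(1/4) ^ n\<close>. The resulting bound gives square
    integrability of \<open>f\<close> for empty \<open>B\<close>, and mean-square convergence as
    \<open>B\<close> grows.\<close>
  have fatou: "(\<integral>\<^sup>+t. ennreal ((cmod (f t - psum u B t))\<^sup>2) \<partial>M) \<le> ennreal (S - s B)" if "finite B" "B \<subseteq> L" for B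
  proof -
    have "(\<integral>\<^sup>+t. ennreal ((cmod (f t - psum u B t))\<^sup>2) \<partial>M)
       = (\<integral>\<^sup>+t. liminf (\<lambda>n. ennreal ((cmod (psum u (A n) t - psum u B t))\<^sup>2)) \<partial>M)"
    proof (rule nn_integral_cong_AE, use conv in eventually_elim)
      case (elim t)
      then have "(\<lambda>n. psum u (A n) t) \<longlonglongrightarrow> f t" unfolding f_def by (simp add: convergent_LIMSEQ_iff)
      then have "(\<lambda>n. ennreal ((cmod (psum u (A n) t - psum u B t))\<^sup>2)) \<longlonglongrightarrow> ennreal ((cmod (f t - psum u B t))\<^sup>2)"
        by (intro tendsto_intros)
      then show ?case by (intro lim_imp_Liminf[symmetric]) auto
    qed
    also have "\<dots> \<le> liminf (\<lambda>n. \<integral>\<^sup>+t. ennreal ((cmod (psum u (A n) t - psum u B t))\<^sup>2) \<partial>M)"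
      by (rule nn_integral_liminf) measurable
    also have "\<dots> \<le> liminf (\<lambda>n. ennreal ((1/4) ^ n + (S - s B)))"
    proof (rule Liminf_mono, rule always_eventually, rule allI)
      fix n
      have "(\<integral>\<^sup>+t. ennreal ((cmod (psum u (A n) t - psum u B t))\<^sup>2) \<partial>M)
         = ennreal (\<integral>t. (cmod (psum u (A n) t - psum u B t))\<^sup>2 \<partial>M)"
        by (rule nn_integral_eq_integral) (use int in auto)
      then show "(\<integral>\<^sup>+t. ennreal ((cmod (psum u (A n) t - psum u B t))\<^sup>2) \<partial>M) \<le> ennreal ((1/4) ^ n + (S - s B))"
        using dist[OF that, of n] by (simp add: ennreal_leI)
    qed
    also have "\<dots> = ennreal (0 + (S - s B))"
      by (intro lim_imp_Liminf tendsto_ennrealI tendsto_add LIMSEQ_power_zero tendsto_const) auto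
    finally show ?thesis by simp
  qed
  have int_f: "integrable M (\<lambda>t. (cmod (f t - psum u B t))\<^sup>2)" if "finite B" "B \<subseteq> L" for B
  proof (rule integrableI_bounded)
    show "(\<integral>\<^sup>+t. ennreal (norm ((cmod (f t - psum u B t))\<^sup>2)) \<partial>M) < \<infinity>"
      using fatou[OF that] le_less_trans by fastforce
  qed measurable
  have "integrable M (\<lambda>t. (cmod (f t))\<^sup>2)"
    using int_f[of "{}"] by (simp add: psum_def)
  moreover have "((\<lambda>B. \<integral>t. (cmod (f t - psum u B t))\<^sup>2 \<partial>M) \<longlongrightarrow> 0) ?F"
  proof (rule tendsto_sandwich[OF _ _ tendsto_const])
    show "((\<lambda>B. S - s B) \<longlongrightarrow> 0) ?F" using tendsto_diff[OF tendsto_const[of S] sS] by simp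
    show "\<forall>\<^sub>F B in ?F. (\<integral>t. (cmod (f t - psum u B t))\<^sup>2 \<partial>M) \<le> S - s B"
    proof (rule eventually_finite_subsets_at_top_weakI)
      fix B assume B: "finite B" "B \<subseteq> L"
      have "ennreal (\<integral>t. (cmod (f t - psum u B t))\<^sup>2 \<partial>M) \<le> ennreal (S - s B)"
        using fatou[OF B] nn_integral_eq_integral[OF int_f[OF B]] by simp
      then show "(\<integral>t. (cmod (f t - psum u B t))\<^sup>2 \<partial>M) \<le> S - s B"
        using s_le[OF B] by (simp add: ennreal_le_iff)
    qed
  qed auto
  ultimately show ?thesis unfolding expands_def using f_meas by blast
qed

end

section \<open>Analysis and synthesis in vector-valued sequence spaces\<close>

lemma norm_vec_power2: "(norm (v :: complex^'s))\<^sup>2 = (\<Sum>k\<in>UNIV. (cmod (v $ k))\<^sup>2)"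
  by (simp add: norm_vec_def L2_set_def sum_nonneg)

definition cinner :: "complex^'s \<Rightarrow> complex^'s \<Rightarrow> complex" where
  "cinner v w = (\<Sum>k\<in>UNIV. v $ k * cnj (w $ k))"

lemma cinner_self: "cinner v v = of_real ((norm v)\<^sup>2)"
  by (simp add: cinner_def norm_vec_power2 complex_norm_square del: of_real_power)

text \<open>A crude bound, enough for absolute summability of the inner product of two
  square-summable families.\<close>

lemma norm_cinner_le: "cmod (cinner v w) \<le> (norm v)\<^sup>2 + (norm w)\<^sup>2"
proof -
  have "cmod (cinner v w) \<le> (\<Sum>k\<in>UNIV. cmod (v $ k) * cmod (w $ k))"
    unfolding cinner_def by (rule order_trans[OF norm_sum]) (simp add: norm_mult)
  also have "\<dots> \<le> (\<Sum>k\<in>UNIV. (cmod (v $ k))\<^sup>2 + (cmod (w $ k))\<^sup>2)"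
  proof (rule sum_mono)
    fix k
    show "cmod (v $ k) * cmod (w $ k) \<le> (cmod (v $ k))\<^sup>2 + (cmod (w $ k))\<^sup>2"
      using sum_squares_bound[of "cmod (v $ k)" "cmod (w $ k)"]
        mult_nonneg_nonneg[OF norm_ge_zero[of "v $ k"] norm_ge_zero[of "w $ k"]] by linarith
  qed
  also have "\<dots> = (norm v)\<^sup>2 + (norm w)\<^sup>2"
    by (simp add: norm_vec_power2 sum.distrib)
  finally show ?thesis .
qed

text \<open>This expresses that the squared norm of \<open>s v - w\<close> is nonnegative; it is
  obtained coordinate by coordinate. The free scale \<open>s\<close> is later set to the Bessel
  bound.\<close>

lemma two_Re_cinner_le:
  fixes s :: real
  shows "2 * s * Re (cinner v w) \<le> s\<^sup>2 * (norm v)\<^sup>2 + (norm w)\<^sup>2"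
proof -
  have "2 * s * Re (cinner v w) = (\<Sum>k\<in>UNIV. 2 * Re (of_real s * v $ k * cnj (w $ k)))"
    by (simp add: cinner_def Re_sum sum_distrib_left algebra_simps)
  also have "\<dots> \<le> (\<Sum>k\<in>UNIV. s\<^sup>2 * (cmod (v $ k))\<^sup>2 + (cmod (w $ k))\<^sup>2)"
  proof (rule sum_mono)
    fix k
    have "2 * Re (of_real s * v $ k * cnj (w $ k)) \<le> 2 * cmod (of_real s * v $ k * cnj (w $ k))"
      by (intro mult_left_mono complex_Re_le_cmod) simp
    also have "\<dots> = 2 * cmod (of_real s * v $ k) * cmod (w $ k)" by (simp add: norm_mult)
    also have "\<dots> \<le> (cmod (of_real s * v $ k))\<^sup>2 + (cmod (w $ k))\<^sup>2" by (rule sum_squares_bound)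
    finally show "2 * Re (of_real s * v $ k * cnj (w $ k)) \<le> s\<^sup>2 * (cmod (v $ k))\<^sup>2 + (cmod (w $ k))\<^sup>2"
      by (simp add: norm_mult power_mult_distrib)
  qed
  also have "\<dots> = s\<^sup>2 * (norm v)\<^sup>2 + (norm w)\<^sup>2"
    by (simp add: norm_vec_power2 sum.distrib sum_distrib_left)
  finally show ?thesis .
qed

lemma has_sum_finite_sum:
  fixes f :: "'i \<Rightarrow> 'a \<Rightarrow> 'b::topological_comm_monoid_add"
  assumes "\<And>i. i \<in> I \<Longrightarrow> (f i has_sum s i) A"
  shows "((\<lambda>x. \<Sum>i\<in>I. f i x) has_sum (\<Sum>i\<in>I. s i)) A"
  using assms by (induction I rule: infinite_finite_induct) (auto intro: has_sum_add)

lemma l2_inner_cinner: "l2_inner L Z W = (\<Sum>\<^sub>\<infinity>x\<in>L. cinner (Z x) (W x))"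
  by (simp add: l2_inner_def cinner_def)

lemma l2_iff: "Z \<in> l2 L \<longleftrightarrow> (\<forall>x. x \<notin> L \<longrightarrow> Z x = 0) \<and> (\<lambda>x. (norm (Z x))\<^sup>2) summable_on L"
  by (simp add: l2_def norm_vec_power2)

lemma l2_norm_summable: "Z \<in> l2 L \<Longrightarrow> (\<lambda>x. (norm (Z x))\<^sup>2) summable_on L"
  by (simp add: l2_iff)

lemma l2_inner_summable:
  assumes "Z \<in> l2 L" "W \<in> l2 L"
  shows "(\<lambda>x. cinner (Z x) (W x)) summable_on L"
proof (rule abs_summable_summable, rule Infinite_Sum.abs_summable_on_comparison_test')
  show "(\<lambda>x. (norm (Z x))\<^sup>2 + (norm (W x))\<^sup>2) summable_on L"
    using assms by (intro summable_on_add l2_norm_summable)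
qed (rule norm_cinner_le)

lemma l2_inner_self:
  assumes "Z \<in> l2 L"
  shows "l2_inner L Z Z = of_real (\<Sum>\<^sub>\<infinity>x\<in>L. (norm (Z x))\<^sup>2)"
  unfolding l2_inner_cinner cinner_self
  by (intro infsumI has_sum_of_real has_sum_infsum l2_norm_summable assms)

lemma l2_norm_power2: "Z \<in> l2 L \<Longrightarrow> (l2_norm L Z)\<^sup>2 = (\<Sum>\<^sub>\<infinity>x\<in>L. (norm (Z x))\<^sup>2)"
  by (simp add: l2_norm_def l2_inner_self infsum_nonneg)

lemma l2_inner_sum_right:
  assumes "Z \<in> l2 L" "\<And>i. i \<in> I \<Longrightarrow> w i \<in> l2 L"
  shows "l2_inner L Z (\<lambda>x. \<Sum>i\<in>I. c i *s w i x) = (\<Sum>i\<in>I. cnj (c i) * l2_inner L Z (w i))"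
proof -
  have "cinner (Z x) (\<Sum>i\<in>I. c i *s w i x) = (\<Sum>i\<in>I. cnj (c i) * cinner (Z x) (w i x))" for x
    unfolding cinner_def
    by (simp add: sum_component sum_distrib_left mult.left_commute) (rule sum.swap)
  moreover have "((\<lambda>x. \<Sum>i\<in>I. cnj (c i) * cinner (Z x) (w i x)) has_sum (\<Sum>i\<in>I. cnj (c i) * l2_inner L Z (w i))) L"
    unfolding l2_inner_cinner
    by (intro has_sum_finite_sum has_sum_cmult_right has_sum_infsum l2_inner_summable assms)
  ultimately show ?thesis unfolding l2_inner_cinner by (simp add: infsumI)
qed

lemma two_Re_l2_inner_le:
  fixes s :: real
  assumes "Z \<in> l2 L" "W \<in> l2 L"
  shows "2 * s * Re (l2_inner L Z W) \<le> s\<^sup>2 * (l2_norm L Z)\<^sup>2 + (l2_norm L W)\<^sup>2"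
proof (rule has_sum_mono)
  show "((\<lambda>x. 2 * s * Re (cinner (Z x) (W x))) has_sum 2 * s * Re (l2_inner L Z W)) L"
    unfolding l2_inner_cinner by (intro has_sum_cmult_right has_sum_Re has_sum_infsum l2_inner_summable assms)
  show "((\<lambda>x. s\<^sup>2 * (norm (Z x))\<^sup>2 + (norm (W x))\<^sup>2) has_sum s\<^sup>2 * (l2_norm L Z)\<^sup>2 + (l2_norm L W)\<^sup>2) L"
    unfolding l2_norm_power2[OF assms(1)] l2_norm_power2[OF assms(2)]
    by (intro has_sum_add has_sum_cmult_right has_sum_infsum l2_norm_summable assms)
qed (rule two_Re_cinner_le)

text \<open>Duality of the analysis and synthesis operators, with
  \<open>2s Re \<langle>Z, Y\<rangle> \<le> s\<^sup>2 \<parallel>Z\<parallel>\<^sup>2 + \<parallel>Y\<parallel>\<^sup>2\<close> at \<open>s = B\<close> in place of the Cauchy--Schwarz inequality.\<close>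

lemma analysis_bound_of_synthesis_bound:
  assumes "Z \<in> l2 L" "\<And>i. i \<in> I \<Longrightarrow> w i \<in> l2 L" "B > 0"
    and Y: "\<And>c. (\<lambda>x. \<Sum>i\<in>I. c i *s w i x) \<in> l2 L"
    and bound: "\<And>c. (l2_norm L (\<lambda>x. \<Sum>i\<in>I. c i *s w i x))\<^sup>2 \<le> B * (\<Sum>i\<in>I. (cmod (c i))\<^sup>2)"
  shows "(\<Sum>i\<in>I. (cmod (l2_inner L Z (w i)))\<^sup>2) \<le> B * (l2_norm L Z)\<^sup>2"
proof -
  \<comment> \<open>With these coefficients the inner product of \<open>Z\<close> with the
    synthesized vector is exactly the sum \<open>T\<close> to be bounded.\<close>
  define c where "c i = l2_inner L Z (w i)" for i
  define T where "T = (\<Sum>i\<in>I. (cmod (c i))\<^sup>2)"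
  have "l2_inner L Z (\<lambda>x. \<Sum>i\<in>I. c i *s w i x) = (\<Sum>i\<in>I. of_real ((cmod (c i))\<^sup>2))"
    by (subst l2_inner_sum_right[OF assms(1,2)]) (simp_all only: complex_norm_square c_def mult.commute)
  also have "\<dots> = of_real T" unfolding T_def by (rule of_real_sum[symmetric])
  \<comment> \<open>The synthesis bound costs only one of the two copies of \<open>B * T\<close>, so
    the other survives and \<open>B\<close> can be cancelled.\<close>
  finally have "2 * B * T \<le> B\<^sup>2 * (l2_norm L Z)\<^sup>2 + B * T"
    using two_Re_l2_inner_le[OF assms(1) Y, of B c] bound[of c] unfolding T_def[symmetric] by simp
  then have "B * T \<le> B * (B * (l2_norm L Z)\<^sup>2)" by (simp add: power2_eq_square algebra_simps)
  then show ?thesis using assms(3) by (simp add: T_def c_def)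
qed

text \<open>The analysis bound is applied to \<open>Y\<close> itself. Expanding one factor of the
  inner product of \<open>Y\<close> with itself and splitting each term with weight \<open>B\<close>
  leaves the sum of squared analysis coefficients, which is absorbed by one copy of \<open>B\<close>
  times the squared norm of \<open>Y\<close>.\<close>

lemma synthesis_bound_of_analysis_bound:
  assumes w: "\<And>i. i \<in> I \<Longrightarrow> w i \<in> l2 L" and "B > 0"
    and Y_eq: "Y = (\<lambda>x. \<Sum>i\<in>I. c i *s w i x)" and Y: "Y \<in> l2 L"
    and bound: "(\<Sum>i\<in>I. (cmod (l2_inner L Y (w i)))\<^sup>2) \<le> B * (l2_norm L Y)\<^sup>2"
  shows "(l2_norm L Y)\<^sup>2 \<le> B * (\<Sum>i\<in>I. (cmod (c i))\<^sup>2)"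
proof -
  define d where "d i = l2_inner L Y (w i)" for i
  have "(l2_norm L Y)\<^sup>2 = Re (l2_inner L Y Y)"
    using Y by (simp add: l2_inner_self l2_norm_power2)
  also have "\<dots> = (\<Sum>i\<in>I. Re (cnj (c i) * d i))"
    unfolding d_def by (subst (2) Y_eq, subst l2_inner_sum_right[OF Y w]) (simp_all add: Re_sum)
  finally have "2 * B * (l2_norm L Y)\<^sup>2 = (\<Sum>i\<in>I. 2 * B * Re (cnj (c i) * d i))"
    by (simp add: sum_distrib_left)
  also have "\<dots> \<le> (\<Sum>i\<in>I. B\<^sup>2 * (cmod (c i))\<^sup>2 + (cmod (d i))\<^sup>2)"
  proof (rule sum_mono)
    fix i
    have "2 * B * Re (cnj (c i) * d i) \<le> 2 * B * (cmod (c i) * cmod (d i))"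
      using complex_Re_le_cmod[of "cnj (c i) * d i"] assms(2) by (simp add: norm_mult)
    also have "\<dots> = 2 * (B * cmod (c i)) * cmod (d i)" by simp
    also have "\<dots> \<le> (B * cmod (c i))\<^sup>2 + (cmod (d i))\<^sup>2" by (rule sum_squares_bound)
    finally show "2 * B * Re (cnj (c i) * d i) \<le> B\<^sup>2 * (cmod (c i))\<^sup>2 + (cmod (d i))\<^sup>2"
      by (simp add: power_mult_distrib)
  qed
  also have "\<dots> = B\<^sup>2 * (\<Sum>i\<in>I. (cmod (c i))\<^sup>2) + (\<Sum>i\<in>I. (cmod (d i))\<^sup>2)"
    by (simp add: sum.distrib sum_distrib_left)
  also have "\<dots> \<le> B\<^sup>2 * (\<Sum>i\<in>I. (cmod (c i))\<^sup>2) + B * (l2_norm L Y)\<^sup>2"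
    using bound by (simp add: d_def)
  finally have "B * (l2_norm L Y)\<^sup>2 \<le> B * (B * (\<Sum>i\<in>I. (cmod (c i))\<^sup>2))"
    by (simp add: power2_eq_square algebra_simps)
  then show ?thesis using assms(2) by simp
qed

section \<open>Trigonometric test functions\<close>

text \<open>On the unit circle the conjugate of \<open>z\<close> is its inverse, so a real
  polynomial in the real and imaginary parts is a Laurent polynomial in \<open>z\<close>. The factor
  \<open>z ^ K\<close> clears the negative powers; under products the exponents add, and sums are
  brought to a common exponent.\<close>

lemma real_polynomial_function_on_circle:
  fixes h :: "complex \<Rightarrow> real"
  assumes "real_polynomial_function h"
  shows "\<exists>K Q. \<forall>z. cmod z = 1 \<longrightarrow> of_real (h z) * z ^ K = poly Q z"
  using assms
proof induction
  case (linear f)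
  interpret bounded_linear f by fact
  \<comment> \<open>The coefficients come from writing the real and imaginary parts through
    \<open>z\<close> and \<open>cnj z\<close>, multiplying by \<open>z\<close>, and replacing
    \<open>z * cnj z\<close> by 1.\<close>
  have "of_real (f z) * z ^ 1 = poly [: of_real (f 1) / 2 + \<i> * of_real (f \<i>) / 2, 0, of_real (f 1) / 2 - \<i> * of_real (f \<i>) / 2 :] z"
    if "cmod z = 1" for z
  proof -
    have c: "z * cnj z = 1" using that complex_norm_square[of z] by simp
    have "f z = f (Re z *\<^sub>R 1 + Im z *\<^sub>R \<i>)" by (rule arg_cong[where f = f]) (simp add: complex_eq_iff)
    then have "f z = Re z * f 1 + Im z * f \<i>" by (simp add: add scaleR)
    moreover have "of_real (Re z) = (z + cnj z) / 2" "of_real (Im z) = - \<i> * (z - cnj z) / 2"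
      by (simp_all add: complex_eq_iff)
    ultimately have "of_real (f z) = (z + cnj z) / 2 * of_real (f 1) + - \<i> * (z - cnj z) / 2 * complex_of_real (f \<i>)"
      by (simp only: of_real_add of_real_mult)
    note fz = this
    have "of_real (f z) * z ^ 1 = ((z * z + z * cnj z) / 2) * of_real (f 1) + (- \<i> * (z * z - z * cnj z) / 2) * of_real (f \<i>)"
      unfolding fz by (simp add: field_simps)
    also have "\<dots> = poly [: of_real (f 1) / 2 + \<i> * of_real (f \<i>) / 2, 0, of_real (f 1) / 2 - \<i> * of_real (f \<i>) / 2 :] z"
      unfolding c by (simp add: field_simps)
    finally show ?thesis .
  qed
  then show ?case by blast
next
  case (const c)
  have "of_real c * z ^ 0 = poly [: of_real c :] z" for z :: complex by simp
  then show ?case by blast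
next
  case (add f g)
  then obtain K1 Q1 K2 Q2 where "\<forall>z. cmod z = 1 \<longrightarrow> of_real (f z) * z ^ K1 = poly Q1 z"
    "\<forall>z. cmod z = 1 \<longrightarrow> of_real (g z) * z ^ K2 = poly Q2 z" by blast
  then have "\<forall>z. cmod z = 1 \<longrightarrow> of_real (f z + g z) * z ^ (K1 + K2) = poly (Q1 * monom 1 K2 + Q2 * monom 1 K1) z"
    by (simp add: poly_monom power_add algebra_simps)
  then show ?case by blast
next
  case (mult f g)
  then obtain K1 Q1 K2 Q2 where "\<forall>z. cmod z = 1 \<longrightarrow> of_real (f z) * z ^ K1 = poly Q1 z"
    "\<forall>z. cmod z = 1 \<longrightarrow> of_real (g z) * z ^ K2 = poly Q2 z" by blast
  then have "\<forall>z. cmod z = 1 \<longrightarrow> of_real (f z * g z) * z ^ (K1 + K2) = poly (Q1 * Q2) z"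
    by (auto simp: power_add mult_ac)
  then show ?case by blast
qed

text \<open>Only moduli are compared, so the factor \<open>z ^ K\<close> disappears: the polynomial
  has the same modulus as the Stone-Weierstrass approximant of \<open>q\<close>, and the reverse
  triangle inequality finishes.\<close>

lemma poly_approximates_on_circle:
  fixes q :: "complex \<Rightarrow> real"
  assumes "continuous_on (sphere 0 1) q" "\<epsilon> > 0"
  shows "\<exists>Q :: complex poly. \<forall>z. cmod z = 1 \<longrightarrow> \<bar>\<bar>q z\<bar> - cmod (poly Q z)\<bar> < \<epsilon>"
proof -
  obtain h where h: "real_polynomial_function h" "\<And>z. z \<in> sphere 0 1 \<Longrightarrow> \<bar>q z - h z\<bar> < \<epsilon>"
    using Stone_Weierstrass_real_polynomial_function[OF compact_sphere assms] by metis
  obtain K Q where Q: "\<And>z. cmod z = 1 \<Longrightarrow> of_real (h z) * z ^ K = poly Q z"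
    using real_polynomial_function_on_circle[OF h(1)] by blast
  have "\<bar>\<bar>q z\<bar> - cmod (poly Q z)\<bar> < \<epsilon>" if "cmod z = 1" for z
  proof -
    have "cmod (poly Q z) = \<bar>h z\<bar>"
      unfolding Q[OF that, symmetric] using that by (simp add: norm_mult norm_power)
    then show ?thesis using h(2)[of z] that by simp
  qed
  then show ?thesis by blast
qed

text \<open>Testing against \<open>\<bar>Q\<bar>\<^sup>2\<close> loses nothing compared with trigonometric polynomials, since these are
  polynomials in \<open>z\<close> up to a unimodular factor \<open>z\<^sup>-\<^sup>K\<close>.\<close>

context
  fixes S :: "real set" and g :: "real \<Rightarrow> real" and q \<beta> :: real
  assumes S: "S \<in> lmeasurable"
    and g: "integrable (lebesgue_on S) g" "\<And>\<xi>. g \<xi> \<ge> 0"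
    and test: "\<And>Q :: complex poly. (\<integral>\<xi>. (cmod (poly Q (cis (2 * pi * q * \<xi>))))\<^sup>2 * g \<xi> \<partial>lebesgue_on S)
        \<le> \<beta> * (\<integral>\<xi>. (cmod (poly Q (cis (2 * pi * q * \<xi>))))\<^sup>2 \<partial>lebesgue_on S)"
begin

text \<open>Squared moduli of polynomials converge boundedly and pointwise on the circle to the
  indicator of \<open>B\<close>. Dominated convergence on both sides of the test inequality then
  gives the claim.\<close>

lemma closed_arc_test:
  assumes B: "closed B" "B \<noteq> {}"
  shows "(\<integral>\<xi>. indicat_real B (cis (2 * pi * q * \<xi>)) * g \<xi> \<partial>lebesgue_on S)
        \<le> \<beta> * (\<integral>\<xi>. indicat_real B (cis (2 * pi * q * \<xi>)) \<partial>lebesgue_on S)"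
proof -
  interpret finite_measure "lebesgue_on S" by (rule finite_measure_lebesgue_on[OF S])
  let ?\<phi> = "\<lambda>\<xi>. cis (2 * pi * q * \<xi>)"
  have [measurable]: "g \<in> borel_measurable (lebesgue_on S)" using g by auto
  have [measurable]: "?\<phi> \<in> borel_measurable (lebesgue_on S)"
    by (intro continuous_imp_measurable_on_sets_lebesgue continuous_intros fmeasurableD S)
  have [measurable]: "B \<in> sets borel" using B by simp
  have [measurable]: "poly Q \<in> borel_measurable borel" for Q :: "complex poly"
    by (intro borel_measurable_continuous_onI continuous_intros)
  \<comment> \<open>Continuous, equal to 1 on \<open>B\<close>, and 0 at distance at least
    \<open>1/n\<close> from \<open>B\<close> for positive \<open>n\<close>.\<close>
  define f where "f n z = max 0 (1 - real n * infdist z B)" for n z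
  have f_le: "0 \<le> f n z" "f n z \<le> 1" for n z
    by (auto simp: f_def infdist_nonneg)
  have "\<exists>Q :: complex poly. \<forall>z. cmod z = 1 \<longrightarrow> \<bar>\<bar>f n z\<bar> - cmod (poly Q z)\<bar> < inverse (real (Suc n))" for n
    unfolding f_def by (intro poly_approximates_on_circle continuous_intros) simp
  then obtain Q :: "nat \<Rightarrow> complex poly" where
    Q: "\<And>n z. cmod z = 1 \<Longrightarrow> \<bar>f n z - cmod (poly (Q n) z)\<bar> < inverse (real (Suc n))"
    using f_le by (simp add: abs_of_nonneg) metis
  have f_lim: "(\<lambda>n. f n z) \<longlonglongrightarrow> indicat_real B z" for z
  proof (cases "z \<in> B")
    case True
    then show ?thesis by (simp add: f_def)
  next
    case False
    \<comment> \<open>Nonemptiness matters here, since \<open>infdist\<close> to the empty set is 0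
      by convention.\<close>
    then have pos: "infdist z B > 0" using B infdist_pos_not_in_closed by blast
    have "\<forall>\<^sub>F n in sequentially. f n z = 0"
    proof (rule eventually_sequentiallyI)
      fix n assume "nat \<lceil>1 / infdist z B\<rceil> \<le> n"
      then have "1 / infdist z B \<le> real n" by linarith
      then show "f n z = 0" using pos by (simp add: f_def pos_divide_le_eq)
    qed
    then show ?thesis using False by (simp add: tendsto_eventually)
  qed
  have Q_lim: "(\<lambda>n. (cmod (poly (Q n) z))\<^sup>2) \<longlonglongrightarrow> indicat_real B z" if "cmod z = 1" for z
  proof -
    have "(\<lambda>n. cmod (poly (Q n) z) - f n z) \<longlonglongrightarrow> 0"
      by (rule Lim_null_comparison[OF _ LIMSEQ_inverse_real_of_nat])
         (use Q[OF that] in \<open>auto intro!: always_eventually less_imp_le simp: abs_minus_commute\<close>)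
    from tendsto_add[OF this f_lim[of z]] have "(\<lambda>n. cmod (poly (Q n) z)) \<longlonglongrightarrow> indicat_real B z" by simp
    from tendsto_power[OF this, of 2] have "(\<lambda>n. (cmod (poly (Q n) z))\<^sup>2) \<longlonglongrightarrow> (indicat_real B z)\<^sup>2" .
    moreover have "(indicat_real B z)\<^sup>2 = indicat_real B z" by (simp split: split_indicator)
    ultimately show ?thesis by metis
  qed
  \<comment> \<open>The approximation error is at most 1 and \<open>f n\<close> is at most 1, so the
    modulus is at most 2.\<close>
  have Q_le: "(cmod (poly (Q n) z))\<^sup>2 \<le> 4" if "cmod z = 1" for n z
  proof -
    have "inverse (real (Suc n)) \<le> 1" by (simp add: field_simps)
    then have "cmod (poly (Q n) z) \<le> 2" using Q[OF that, of n] f_le(2)[of n z] by linarith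
    then show ?thesis using power_mono[of "cmod (poly (Q n) z)" 2 2] by simp
  qed
  have lim1: "(\<lambda>n. \<integral>\<xi>. (cmod (poly (Q n) (?\<phi> \<xi>)))\<^sup>2 * g \<xi> \<partial>lebesgue_on S)
     \<longlonglongrightarrow> (\<integral>\<xi>. indicat_real B (?\<phi> \<xi>) * g \<xi> \<partial>lebesgue_on S)"
  proof (rule integral_dominated_convergence)
    show "integrable (lebesgue_on S) (\<lambda>\<xi>. 4 * g \<xi>)" using g by simp
    show "AE \<xi> in lebesgue_on S. (\<lambda>n. (cmod (poly (Q n) (?\<phi> \<xi>)))\<^sup>2 * g \<xi>) \<longlonglongrightarrow> indicat_real B (?\<phi> \<xi>) * g \<xi>"
      by (intro AE_I2 tendsto_mult Q_lim tendsto_const) simp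
    show "AE \<xi> in lebesgue_on S. norm ((cmod (poly (Q n) (?\<phi> \<xi>)))\<^sup>2 * g \<xi>) \<le> 4 * g \<xi>" for n
      using g Q_le by (auto simp: abs_mult intro!: AE_I2 mult_right_mono)
  qed measurable
  have lim2: "(\<lambda>n. \<integral>\<xi>. (cmod (poly (Q n) (?\<phi> \<xi>)))\<^sup>2 \<partial>lebesgue_on S)
     \<longlonglongrightarrow> (\<integral>\<xi>. indicat_real B (?\<phi> \<xi>) \<partial>lebesgue_on S)"
  proof (rule integral_dominated_convergence)
    show "integrable (lebesgue_on S) (\<lambda>\<xi>. 4 :: real)" by simp
    show "AE \<xi> in lebesgue_on S. (\<lambda>n. (cmod (poly (Q n) (?\<phi> \<xi>)))\<^sup>2) \<longlonglongrightarrow> indicat_real B (?\<phi> \<xi>)"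
      by (intro AE_I2 Q_lim) simp
    show "AE \<xi> in lebesgue_on S. norm ((cmod (poly (Q n) (?\<phi> \<xi>)))\<^sup>2) \<le> 4" for n
      using Q_le by (intro AE_I2) auto
  qed measurable
  show ?thesis
    by (rule LIMSEQ_le[OF lim1 tendsto_mult[OF tendsto_const lim2]]) (use test in blast)
qed

text \<open>Two points of \<open>S\<close> with the same value of
  \<open>cis (2 * pi * q * _)\<close> differ by \<open>k / q\<close> for an integer \<open>k\<close>
  with \<open>\<bar>k\<bar> \<le> q * R\<close>. Hence the part of \<open>S\<close> lying over the
  image of a compact \<open>T\<close> is covered by \<open>card K\<close> translates of
  \<open>T\<close>, and the closed-set test bounds the integral of \<open>g\<close> over
  \<open>T\<close> by \<open>C\<close> times the measure of \<open>T\<close>. This contradicts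
  \<open>g > C\<close> on a \<open>T\<close> of positive measure.\<close>

lemma AE_bound_of_poly_test:
  assumes "q > 0" "\<beta> \<ge> 0" "S \<subseteq> {0..R}"
  shows "AE \<xi> in lebesgue_on S. g \<xi> \<le> \<beta> * card {k::int. \<bar>real_of_int k\<bar> \<le> q * R}"
proof -
  interpret finite_measure "lebesgue_on S" by (rule finite_measure_lebesgue_on[OF S])
  let ?\<phi> = "\<lambda>\<xi>. cis (2 * pi * q * \<xi>)"
  define K where "K = {k::int. \<bar>real_of_int k\<bar> \<le> q * R}"
  define C where "C = \<beta> * card K"
  have finK: "finite K"
  proof (rule finite_subset)
    show "K \<subseteq> {- \<lceil>q * R\<rceil>..\<lceil>q * R\<rceil>}" unfolding K_def by (auto; linarith)
  qed simp
  have Ss: "S \<in> sets lebesgue" using S by (rule fmeasurableD)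
  have [measurable]: "g \<in> borel_measurable (lebesgue_on S)" using g by auto
  have phi [measurable]: "?\<phi> \<in> borel_measurable (lebesgue_on S)"
    by (intro continuous_imp_measurable_on_sets_lebesgue continuous_intros Ss)
  define E where "E = {\<xi> \<in> S. C < g \<xi>}"
  have ES: "E \<in> sets (lebesgue_on S)"
  proof -
    have "{\<xi> \<in> space (lebesgue_on S). C < g \<xi>} \<in> sets (lebesgue_on S)" by measurable
    then show ?thesis by (simp add: E_def)
  qed
  then have El: "E \<in> sets lebesgue" using sets_restrict_space_iff[of S lebesgue E] Ss by simp
  have "E \<in> null_sets lebesgue"
  proof (rule ccontr)
    assume "E \<notin> null_sets lebesgue"
    have "E \<in> lmeasurable"
      by (rule fmeasurableI2[OF S]) (use El in \<open>auto simp: E_def\<close>)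
    then have mE: "measure lebesgue E > 0"
      using \<open>E \<notin> null_sets lebesgue\<close> by (metis measure_nonneg negligible_iff_measure0 negligible_iff_null_sets order_le_less)
    \<comment> \<open>The measure of \<open>E\<close> serves as the tolerance in inner regularity,
      which forces \<open>T\<close> to have positive measure. Being also bounded, \<open>T\<close>
      is compact, so its image on the circle is closed.\<close>
    obtain T where T: "closed T" "T \<subseteq> E" "E - T \<in> lmeasurable" "emeasure lebesgue (E - T) < ennreal (measure lebesgue E)"
      using sets_lebesgue_inner_closed[OF El mE] by blast
    have "T \<subseteq> S" using T(2) by (auto simp: E_def)
    have "compact T"
      using T(1) \<open>T \<subseteq> S\<close> assms(3) by (meson bounded_closed_interval bounded_subset compact_eq_bounded_closed)
    then have Tm: "T \<in> lmeasurable" by (rule lmeasurable_compact)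
    have mT: "measure lebesgue T > 0"
    proof -
      have "measure lebesgue (E - T) < measure lebesgue E"
        using T(3,4) by (simp add: emeasure_eq_measure2 ennreal_less_iff)
      moreover have "measure lebesgue (E - T) = measure lebesgue E - measure lebesgue T"
        by (rule measurable_measure_Diff) (use \<open>E \<in> lmeasurable\<close> Tm T(2) in auto)
      ultimately show ?thesis by simp
    qed
    define B where "B = ?\<phi> ` T"
    have "compact B" unfolding B_def by (intro compact_continuous_image continuous_intros \<open>compact T\<close>)
    then have "closed B" by (rule compact_imp_closed)
    have "B \<noteq> {}" using mT unfolding B_def by auto
    have Tset: "T \<in> sets (lebesgue_on S)"
      using Tm \<open>T \<subseteq> S\<close> Ss by (simp add: sets_restrict_space_iff fmeasurableD)
    \<comment> \<open>The part in \<open>S\<close> of the periodisation of \<open>T\<close> with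
      period \<open>1/q\<close>.\<close>
    define V where "V = {\<xi> \<in> S. ?\<phi> \<xi> \<in> B}"
    have VS: "V \<in> sets (lebesgue_on S)"
    proof -
      have "B \<in> sets borel" using \<open>closed B\<close> by simp
      from measurable_sets[OF phi this] show ?thesis
        by (simp add: V_def vimage_def Int_def conj_commute)
    qed
    then have "V \<in> sets lebesgue" using Ss by (simp add: sets_restrict_space_iff)
    then have Vl: "V \<in> lmeasurable" by (rule fmeasurableI2[OF S, rotated]) (auto simp: V_def)
    have "V \<subseteq> (\<Union>k\<in>K. (\<lambda>x. real_of_int k / q + x) ` T)"
    proof
      fix \<xi> assume "\<xi> \<in> V"
      then obtain \<eta> where \<eta>: "\<eta> \<in> T" "?\<phi> \<xi> = ?\<phi> \<eta>" "\<xi> \<in> S" by (auto simp: V_def B_def)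
      then obtain k :: int where k: "2 * pi * q * \<xi> = 2 * pi * q * \<eta> + 2 * pi * k"
        using sin_cos_eq_iff by (metis cis.sel(1) cis.sel(2))
      then have "2 * pi * (q * (\<xi> - \<eta>)) = 2 * pi * k" by (simp add: algebra_simps)
      then have k': "q * (\<xi> - \<eta>) = k" by simp
      have "\<xi> \<in> {0..R}" "\<eta> \<in> {0..R}" using \<eta>(1,3) \<open>T \<subseteq> S\<close> assms(3) by blast+
      then have "\<bar>\<xi> - \<eta>\<bar> \<le> R" by auto
      then have "k \<in> K" using assms(1) unfolding K_def by (simp add: k'[symmetric] abs_mult)
      moreover have "\<xi> = k / q + \<eta>" using assms(1) k' by (simp add: field_simps)
      ultimately show "\<xi> \<in> (\<Union>k\<in>K. (\<lambda>x. real_of_int k / q + x) ` T)" using \<eta>(1) by blast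
    qed
    then have "measure lebesgue V \<le> measure lebesgue (\<Union>k\<in>K. (\<lambda>x. real_of_int k / q + x) ` T)"
      using Vl Tm finK by (intro measure_mono_fmeasurable) (auto intro!: fmeasurable.finite_UN measurable_translation fmeasurableD)
    also have "\<dots> \<le> (\<Sum>k\<in>K. measure lebesgue ((\<lambda>x. real_of_int k / q + x) ` T))"
      using Tm finK by (intro measure_UNION_le) (auto intro!: fmeasurableD measurable_translation)
    also have "\<dots> = card K * measure lebesgue T" by (simp add: measure_translation)
    finally have V_le: "measure lebesgue V \<le> card K * measure lebesgue T" .
    have int: "integrable (lebesgue_on S) (\<lambda>\<xi>. indicat_real T \<xi> * g \<xi>)"
      "integrable (lebesgue_on S) (indicat_real T)"
      using integrable_mult_indicator[OF Tset g(1)] sets.Int_space_eq2[OF Tset] Tset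
      by (simp_all add: integrable_indicator_iff emeasure_eq_measure)
    have "(\<integral>\<xi>. indicat_real T \<xi> * g \<xi> \<partial>lebesgue_on S) \<le> (\<integral>\<xi>. indicat_real B (?\<phi> \<xi>) * g \<xi> \<partial>lebesgue_on S)"
    proof (rule integral_mono)
      show "integrable (lebesgue_on S) (\<lambda>\<xi>. indicat_real B (?\<phi> \<xi>) * g \<xi>)"
      proof (rule Bochner_Integration.integrable_bound[OF g(1)])
        have [measurable]: "B \<in> sets borel" using \<open>closed B\<close> by simp
        show "(\<lambda>\<xi>. indicat_real B (?\<phi> \<xi>) * g \<xi>) \<in> borel_measurable (lebesgue_on S)" by measurable
      qed (auto simp: indicator_def)
    qed (use int g(2) in \<open>auto simp: indicator_def B_def\<close>)
    also have "\<dots> \<le> \<beta> * (\<integral>\<xi>. indicat_real B (?\<phi> \<xi>) \<partial>lebesgue_on S)"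
      by (rule closed_arc_test) fact+
    also have "(\<integral>\<xi>. indicat_real B (?\<phi> \<xi>) \<partial>lebesgue_on S) = (\<integral>\<xi>. indicat_real V \<xi> \<partial>lebesgue_on S)"
      by (rule Bochner_Integration.integral_cong) (auto simp: V_def indicator_def)
    also have "\<dots> = measure lebesgue V"
      using Ss by (simp add: measure_restrict_space V_def Int_absorb2)
    also have "\<beta> * measure lebesgue V \<le> C * measure lebesgue T"
      using mult_left_mono[OF V_le assms(2)] by (simp add: C_def mult.assoc)
    also have "C * measure lebesgue T = (\<integral>\<xi>. C * indicat_real T \<xi> \<partial>lebesgue_on S)"
      using Ss \<open>T \<subseteq> S\<close> by (simp add: measure_restrict_space Int_absorb2)
    \<comment> \<open>The integrand is nonnegative, and strictly positive on \<open>T\<close>, so a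
      nonpositive integral makes \<open>T\<close> null.\<close>
    finally have "(\<integral>\<xi>. indicat_real T \<xi> * (g \<xi> - C) \<partial>lebesgue_on S) \<le> 0"
      using int by (simp add: right_diff_distrib mult.commute)
    moreover have nn: "0 \<le> indicat_real T \<xi> * (g \<xi> - C)" for \<xi>
      using T(2) by (auto simp: indicator_def E_def)
    ultimately have "(\<integral>\<xi>. indicat_real T \<xi> * (g \<xi> - C) \<partial>lebesgue_on S) = 0"
      by (intro antisym integral_nonneg_AE) auto
    moreover have "integrable (lebesgue_on S) (\<lambda>\<xi>. indicat_real T \<xi> * (g \<xi> - C))"
      using int by (simp add: right_diff_distrib)
    ultimately have "AE \<xi> in lebesgue_on S. indicat_real T \<xi> * (g \<xi> - C) = 0"
      using nn by (subst integral_nonneg_eq_0_iff_AE[symmetric]) auto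
    then have "AE \<xi> in lebesgue_on S. \<xi> \<notin> T"
      by eventually_elim (use T(2) in \<open>auto simp: E_def indicator_def\<close>)
    then have "emeasure (lebesgue_on S) T = 0"
      using Tset by (subst (asm) AE_iff_null_sets[symmetric]) auto
    then have "measure lebesgue T = 0"
      using Ss \<open>T \<subseteq> S\<close> by (simp add: emeasure_restrict_space measure_def)
    with mT show False by simp
  qed
  then have "E \<in> null_sets (lebesgue_on S)"
    using Ss by (simp add: null_sets_restrict_space E_def)
  then have "AE \<xi> in lebesgue_on S. \<xi> \<notin> E" by (rule AE_not_in)
  moreover have "AE \<xi> in lebesgue_on S. \<xi> \<in> S" by (rule AE_I2) simp
  ultimately show ?thesis unfolding K_def[symmetric] C_def[symmetric]
    by eventually_elim (auto simp: E_def)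
qed

end

section \<open>The nonuniform lattice and its spectrum\<close>

lemma Omega_lmeasurable: "Omega N \<in> lmeasurable"
proof (rule bounded_set_imp_lmeasurable)
  have "Omega N \<subseteq> {0..real N + 1}" by (auto simp: Omega_def)
  then show "bounded (Omega N)" by (rule bounded_subset[rotated]) simp
qed (simp add: Omega_def)

lemma has_integral_cis_interval:
  assumes "d \<noteq> 0" "a \<le> b"
  shows "((\<lambda>\<xi>. cis (2 * pi * d * \<xi>)) has_integral
    (cis (2 * pi * d * b) - cis (2 * pi * d * a)) / (of_real (2 * pi * d) * \<i>)) {a..<b}"
proof -
  have "((\<lambda>\<xi>. cis (2 * pi * d * \<xi>)) has_integral
     cis (2 * pi * d * b) / (of_real (2 * pi * d) * \<i>) - cis (2 * pi * d * a) / (of_real (2 * pi * d) * \<i>)) {a..b}"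
  proof (rule fundamental_theorem_of_calculus[OF assms(2)])
    fix \<xi> :: real
    have "((\<lambda>z. exp (\<i> * of_real (2 * pi * d) * z) / (of_real (2 * pi * d) * \<i>)) has_field_derivative exp (\<i> * of_real (2 * pi * d) * \<xi>)) (at (of_real \<xi>))"
      using assms(1) by (auto intro!: derivative_eq_intros)
    from has_vector_derivative_real_field[OF this]
    show "((\<lambda>\<xi>. cis (2 * pi * d * \<xi>) / (of_real (2 * pi * d) * \<i>)) has_vector_derivative cis (2 * pi * d * \<xi>)) (at \<xi> within {a..b})"
      by (simp add: cis_conv_exp mult.assoc)
  qed
  moreover have "negligible ({a..b} - {a..<b})"
    by (rule negligible_subset[of "{b}"]) auto
  ultimately show ?thesis
    by (subst has_integral_spike_set_eq[of _ "{a..b}"]) (auto simp: diff_divide_distrib elim: negligible_subset)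
qed

text \<open>The second interval is the first one shifted by \<open>N/2\<close>, so the integral
  factors. The first factor vanishes when \<open>d\<close> is an even integer, the second when
  \<open>d * N\<close> is an odd integer.\<close>

lemma integral_Omega_cis:
  assumes "N \<ge> 1" "d \<noteq> 0"
  shows "(\<integral>\<xi>. cis (2 * pi * d * \<xi>) \<partial>lebesgue_on (Omega N))
     = (cis (pi * d) - 1) * (1 + cis (pi * d * real N)) / (of_real (2 * pi * d) * \<i>)"
proof -
  interpret finite_measure "lebesgue_on (Omega N)"
    by (rule finite_measure_lebesgue_on[OF Omega_lmeasurable])
  have "integrable (lebesgue_on (Omega N)) (\<lambda>\<xi>. cis (2 * pi * d * \<xi>))"
    by (rule integrable_const_bound[where B = 1])
       (auto intro!: continuous_imp_measurable_on_sets_lebesgue continuous_intros fmeasurableD Omega_lmeasurable)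
  then have "(\<integral>\<xi>. cis (2 * pi * d * \<xi>) \<partial>lebesgue_on (Omega N)) = integral (Omega N) (\<lambda>\<xi>. cis (2 * pi * d * \<xi>))"
    by (rule lebesgue_integral_eq_integral) (simp add: fmeasurableD Omega_lmeasurable)
  also have "\<dots> = (cis (2 * pi * d * (1/2)) - cis (2 * pi * d * 0)) / (of_real (2 * pi * d) * \<i>)
      + (cis (2 * pi * d * ((real N + 1) / 2)) - cis (2 * pi * d * (real N / 2))) / (of_real (2 * pi * d) * \<i>)"
  proof -
    have "{0..<1/2} \<inter> {real N / 2..<(real N + 1) / 2} = {}" using assms(1) by auto
    then have "negligible ({0..<1/2} \<inter> {real N / 2..<(real N + 1) / 2})" by simp
    from has_integral_Un[OF has_integral_cis_interval[OF assms(2)] has_integral_cis_interval[OF assms(2)] this]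
    show ?thesis unfolding Omega_def by (intro integral_unique) simp
  qed
  also have "\<dots> = (cis (pi * d) - 1) * (1 + cis (pi * d * real N)) / (of_real (2 * pi * d) * \<i>)"
  proof -
    have "2 * pi * d * ((real N + 1) / 2) = pi * d + pi * d * real N" "2 * pi * d * (real N / 2) = pi * d * real N"
      "2 * pi * d * (1/2) = pi * d"
      by (simp_all add: field_simps)
    then have "cis (2 * pi * d * ((real N + 1) / 2)) = cis (pi * d) * cis (pi * d * real N)"
      "cis (2 * pi * d * (real N / 2)) = cis (pi * d * real N)" "cis (2 * pi * d * (1/2)) = cis (pi * d)"
      by (simp_all only: cis_mult)
    then show ?thesis unfolding add_divide_distrib[symmetric] by (simp add: ring_distribs)
  qed
  finally show ?thesis .
qed

lemma measure_Omega:
  assumes "N \<ge> 1" shows "measure lebesgue (Omega N) = 1"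
proof -
  have "measure lebesgue (Omega N) = measure lebesgue {0..<1/2::real} + measure lebesgue {real N / 2..<(real N + 1) / 2}"
    unfolding Omega_def by (rule measure_Union) (use assms in auto)
  then show ?thesis by (simp add: field_simps)
qed

lemma Lam_diff_cases:
  assumes "x \<in> Lam N r" "y \<in> Lam N r"
  obtains n :: int where "x - y = 2 * of_int n"
  | n :: int where "x - y = real r / real N + 2 * of_int n"
  | n :: int where "x - y = - real r / real N + 2 * of_int n"
proof -
  obtain c n c' n' where "x = c + 2 * of_int n" "y = c' + 2 * of_int n'"
    "c \<in> {0, real r / real N}" "c' \<in> {0, real r / real N}"
    using assms unfolding Lam_def by blast
  then show ?thesis using that(1)[of "n - n'"] that(2)[of "n - n'"] that(3)[of "n - n'"] by auto
qed

lemma cis_pi_odd: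
  fixes k :: int
  assumes "odd k" shows "cis (pi * of_int k) = -1"
proof -
  obtain l where "k = 2 * l + 1" using assms by (elim oddE)
  then have "cis (pi * of_int k) = cis (2 * pi * of_int l + pi)"
    by (simp add: algebra_simps)
  also have "\<dots> = cis (2 * pi * of_int l) * cis pi" by (rule cis_mult[symmetric])
  finally show ?thesis by (simp add: cis_multiple_2pi)
qed

text \<open>Differences of lattice points are either even integers or \<open>r/N\<close> up to sign
  plus an even integer. In the latter case \<open>N\<close> times the difference is odd because
  \<open>r\<close> is. Each case kills one factor of \<open>integral_Omega_cis\<close>; on the
  diagonal the total mass 1 of \<open>Omega N\<close> appears.\<close>

lemma Lam_unimodular_orthonormal:
  assumes "N \<ge> 1" "odd r"
  shows "unimodular_orthonormal (lebesgue_on (Omega N)) (\<lambda>x \<xi>. cis (2 * pi * x * \<xi>)) (Lam N r)"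
proof -
  interpret finite_measure "lebesgue_on (Omega N)"
    by (rule finite_measure_lebesgue_on[OF Omega_lmeasurable])
  show ?thesis
  proof unfold_locales
    fix x y assume xy: "x \<in> Lam N r" "y \<in> Lam N r"
    have "(\<integral>\<xi>. cis (2 * pi * x * \<xi>) * cnj (cis (2 * pi * y * \<xi>)) \<partial>lebesgue_on (Omega N))
       = (\<integral>\<xi>. cis (2 * pi * (x - y) * \<xi>) \<partial>lebesgue_on (Omega N))"
      by (simp add: cis_cnj cis_mult algebra_simps)
    also have "\<dots> = of_bool (x = y)"
    proof (cases "x = y")
      case True
      then show ?thesis using measure_Omega[OF assms(1)]
        by (simp add: measure_restrict_space fmeasurableD Omega_lmeasurable)
    next
      case False
      have eq: "cis (pi * (x - y) * N) = -1" if "(x - y) * N = of_int k" "odd k" for k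
        using cis_pi_odd[OF that(2)] that(1) by (simp add: mult.assoc)
      have "(cis (pi * (x - y)) - 1) * (1 + cis (pi * (x - y) * N)) = 0"
        using xy
      proof (cases rule: Lam_diff_cases)
        case (1 n)
        then have "cis (pi * (x - y)) = cis (2 * pi * of_int n)" by (simp add: mult_ac)
        then show ?thesis by (simp add: cis_multiple_2pi)
      next
        case (2 n)
        then have "(x - y) * N = of_int (int r + 2 * n * int N)" using assms(1) by (simp add: field_simps)
        from eq[OF this] show ?thesis using assms(2) by simp
      next
        case (3 n)
        then have "(x - y) * N = of_int (- int r + 2 * n * int N)" using assms(1) by (simp add: field_simps)
        from eq[OF this] show ?thesis using assms(2) by simp
      qed
      then show ?thesis using False integral_Omega_cis[OF assms(1), of "x - y"] by simp
    qed
    finally show "(\<integral>\<xi>. cis (2 * pi * x * \<xi>) * cnj (cis (2 * pi * y * \<xi>)) \<partial>lebesgue_on (Omega N)) = of_bool (x = y)" .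
  qed (auto intro!: continuous_imp_measurable_on_sets_lebesgue continuous_intros fmeasurableD Omega_lmeasurable)
qed

lemma Lam_add_even: "x \<in> Lam N r \<Longrightarrow> x + 2 * of_int n \<in> Lam N r"
proof -
  assume "x \<in> Lam N r"
  then obtain c k where "c \<in> {0, real r / real N}" "x = c + 2 * of_int k" unfolding Lam_def by blast
  then show ?thesis unfolding Lam_def by (auto intro!: exI[of _ c] exI[of _ "k + n"])
qed

lemma even_subset_Lam: "range (\<lambda>n::int. 2 * real_of_int n) \<subseteq> Lam N r"
  unfolding Lam_def by force

lemma Lam_diff_even_iff:
  assumes "a \<in> range (\<lambda>n::int. 2 * real_of_int n)"
  shows "x - a \<in> Lam N r \<longleftrightarrow> x \<in> Lam N r"
proof -
  obtain n :: int where a: "a = 2 * of_int n" using assms by auto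
  show ?thesis using Lam_add_even[of "x - a" N r n] Lam_add_even[of x N r "- n"] by (auto simp: a)
qed

lemma norm_vector_smult: "norm (c *s (v :: complex^'s)) = cmod c * norm v"
  by (rule power2_eq_imp_eq)
     (simp_all add: norm_vec_power2 power_mult_distrib norm_mult sum_distrib_left)

section \<open>Fourier transforms of sequences on the lattice\<close>

locale nonuniform_lattice =
  fixes N r :: nat
  assumes N: "N \<ge> 1" and r: "odd r"
begin

abbreviation "\<L> \<equiv> Lam N r"
abbreviation "\<mu> \<equiv> lebesgue_on (Omega N)"
abbreviation "evens \<equiv> range (\<lambda>n::int. 2 * real_of_int n)"

sublocale unimodular_orthonormal \<mu> "\<lambda>x \<xi>. cis (2 * pi * x * \<xi>)" \<L>
  using Lam_unimodular_orthonormal[OF N r] .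

lemma is_fourier_iff_expands:
  "is_fourier \<L> (Omega N) Z f \<longleftrightarrow> (\<forall>k. expands (\<lambda>x. Z x $ k) (\<lambda>\<xi>. f \<xi> $ k))"
  unfolding is_fourier_def expands_def psum_def ..

text \<open>Riesz-Fischer in each coordinate provides a representative, which justifies the choice
  made in \<open>fourier\<close>.\<close>

lemma is_fourier_fourier:
  assumes "Z \<in> l2 \<L>"
  shows "is_fourier \<L> (Omega N) Z (fourier \<L> (Omega N) Z)"
proof -
  have "\<exists>f. expands (\<lambda>x. Z x $ k) f" for k
  proof (rule expands_exists, rule summable_on_comparison_test)
    show "(\<lambda>x. (norm (Z x))\<^sup>2) summable_on \<L>" using assms by (simp add: l2_iff)
  qed (auto intro: power_mono Finite_Cartesian_Product.norm_nth_le)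
  then obtain f where f: "\<And>k. expands (\<lambda>x. Z x $ k) (f k)" by metis
  have "is_fourier \<L> (Omega N) Z (\<lambda>\<xi>. \<chi> k. f k \<xi>)"
    unfolding is_fourier_iff_expands using f by simp
  then show ?thesis unfolding fourier_def by (rule someI[of "is_fourier \<L> (Omega N) Z"])
qed

lemma is_fourier_norm_integrable:
  assumes "is_fourier \<L> (Omega N) Z f"
  shows "integrable \<mu> (\<lambda>\<xi>. (norm (f \<xi>))\<^sup>2)"
  using assms unfolding is_fourier_def norm_vec_power2 by auto

lemma is_fourier_parseval:
  assumes "is_fourier \<L> (Omega N) Z f"
  shows "((\<lambda>x. (norm (Z x))\<^sup>2) has_sum (\<integral>\<xi>. (norm (f \<xi>))\<^sup>2 \<partial>\<mu>)) \<L>"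
proof -
  have ex: "expands (\<lambda>x. Z x $ k) (\<lambda>\<xi>. f \<xi> $ k)" for k
    using assms by (simp add: is_fourier_iff_expands)
  have "((\<lambda>x. (norm (Z x))\<^sup>2) has_sum (\<Sum>k\<in>UNIV. \<integral>\<xi>. (cmod (f \<xi> $ k))\<^sup>2 \<partial>\<mu>)) \<L>"
    unfolding norm_vec_power2 by (intro has_sum_finite_sum expands_parseval ex)
  also have "(\<Sum>k\<in>UNIV. \<integral>\<xi>. (cmod (f \<xi> $ k))\<^sup>2 \<partial>\<mu>) = (\<integral>\<xi>. (norm (f \<xi>))\<^sup>2 \<partial>\<mu>)"
    unfolding norm_vec_power2 using ex by (subst Bochner_Integration.integral_sum) (auto simp: expands_def)
  finally show ?thesis .
qed

text \<open>Translation by an even integer permutes the lattice, hence preserves the filter of its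
  finite subsets. After this reindexing the error differs from the original one only by a unimodular
  factor.\<close>

lemma expands_shift:
  assumes "expands u f" "a \<in> evens"
  shows "expands (\<lambda>x. u (x - a)) (\<lambda>\<xi>. cis (2 * pi * a * \<xi>) * f \<xi>)"
proof -
  let ?err = "\<lambda>A. \<integral>\<xi>. (cmod (f \<xi> - psum u A \<xi>))\<^sup>2 \<partial>\<mu>"
  have [measurable]: "f \<in> borel_measurable \<mu>" using assms by (simp add: expands_def)
  have im: "(\<lambda>x. x - a) ` \<L> = \<L>"
  proof (intro equalityI subsetI)
    fix x assume "x \<in> \<L>"
    then show "x \<in> (\<lambda>x. x - a) ` \<L>"
      by (intro image_eqI[of _ _ "x + a"]) (use Lam_diff_even_iff[OF assms(2), of "x + a"] in auto)
  qed (use Lam_diff_even_iff[OF assms(2)] in auto)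
  have "filtermap ((`) (\<lambda>x. x - a)) (finite_subsets_at_top \<L>) = finite_subsets_at_top \<L>"
    using filtermap_image_finite_subsets_at_top[of "\<lambda>x. x - a" \<L>] im by (simp add: inj_on_def)
  moreover have "(?err \<longlongrightarrow> 0) (finite_subsets_at_top \<L>)" using assms(1) by (simp add: expands_def)
  ultimately have "(?err \<longlongrightarrow> 0) (filtermap ((`) (\<lambda>x. x - a)) (finite_subsets_at_top \<L>))"
    by simp
  then have "((\<lambda>A. ?err ((\<lambda>x. x - a) ` A)) \<longlongrightarrow> 0) (finite_subsets_at_top \<L>)"
    unfolding filterlim_filtermap .
  moreover have "cmod (cis (2 * pi * a * \<xi>) * f \<xi> - psum (\<lambda>x. u (x - a)) A \<xi>) = cmod (f \<xi> - psum u ((\<lambda>x. x - a) ` A) \<xi>)" for A \<xi>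
  proof -
    have "psum u ((\<lambda>x. x - a) ` A) \<xi> = (\<Sum>x\<in>A. u (x - a) * cis (2 * pi * (x - a) * \<xi>))"
      unfolding psum_def by (subst sum.reindex) (auto simp: inj_on_def)
    moreover have "cis (2 * pi * a * \<xi>) * (u (x - a) * cis (2 * pi * (x - a) * \<xi>)) = u (x - a) * cis (2 * pi * x * \<xi>)" for x
    proof -
      have "cis (2 * pi * a * \<xi>) * cis (2 * pi * (x - a) * \<xi>) = cis (2 * pi * x * \<xi>)"
        unfolding cis_mult by (simp add: algebra_simps)
      then show ?thesis by (metis mult.left_commute)
    qed
    ultimately have "psum (\<lambda>x. u (x - a)) A \<xi> = cis (2 * pi * a * \<xi>) * psum u ((\<lambda>x. x - a) ` A) \<xi>"
      by (simp only: sum_distrib_left psum_def)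
    then have "cis (2 * pi * a * \<xi>) * f \<xi> - psum (\<lambda>x. u (x - a)) A \<xi> = cis (2 * pi * a * \<xi>) * (f \<xi> - psum u ((\<lambda>x. x - a) ` A) \<xi>)"
      by (simp add: algebra_simps)
    then show ?thesis by (simp add: norm_mult)
  qed
  ultimately show ?thesis using assms(1) unfolding expands_def by (simp add: norm_mult)
qed

section \<open>Synthesis by even translates\<close>

definition synth :: "(real \<Rightarrow> complex^'s) \<Rightarrow> real set \<Rightarrow> (real \<Rightarrow> complex) \<Rightarrow> real \<Rightarrow> complex^'s" where
  "synth V F c x = (\<Sum>a\<in>F. c a *s transl a V x)"

lemma is_fourier_synth:
  assumes "is_fourier \<L> (Omega N) V v" "F \<subseteq> evens"
  shows "is_fourier \<L> (Omega N) (synth V F c) (\<lambda>\<xi>. psum c F \<xi> *s v \<xi>)"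
  unfolding is_fourier_iff_expands
proof
  fix k
  have "expands (\<lambda>x. \<Sum>a\<in>F. c a * V (x - a) $ k) (\<lambda>\<xi>. \<Sum>a\<in>F. c a * (cis (2 * pi * a * \<xi>) * v \<xi> $ k))"
    using assms by (intro expands_sum expands_cmult expands_shift) (auto simp: is_fourier_iff_expands)
  moreover have "(psum c F \<xi> *s v \<xi>) $ k = (\<Sum>a\<in>F. c a * (cis (2 * pi * a * \<xi>) * v \<xi> $ k))" for \<xi>
    unfolding psum_def by (simp add: sum_distrib_right mult.assoc)
  moreover have "synth V F c x $ k = (\<Sum>a\<in>F. c a * V (x - a) $ k)" for x
    by (simp add: synth_def transl_def)
  ultimately show "expands (\<lambda>x. synth V F c x $ k) (\<lambda>\<xi>. (psum c F \<xi> *s v \<xi>) $ k)"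
    by simp
qed

lemma synth_parseval:
  assumes "is_fourier \<L> (Omega N) V v" "F \<subseteq> evens"
  shows "((\<lambda>x. (norm (synth V F c x))\<^sup>2) has_sum (\<integral>\<xi>. (cmod (psum c F \<xi>))\<^sup>2 * (norm (v \<xi>))\<^sup>2 \<partial>\<mu>)) \<L>"
    and "integrable \<mu> (\<lambda>\<xi>. (cmod (psum c F \<xi>))\<^sup>2 * (norm (v \<xi>))\<^sup>2)"
  using is_fourier_parseval[OF is_fourier_synth[OF assms]] is_fourier_norm_integrable[OF is_fourier_synth[OF assms]]
  by (simp_all add: norm_vector_smult power_mult_distrib)

text \<open>Square summability is read off Parseval's identity, because \<open>has_sum\<close>
  includes convergence.\<close>

lemma synth_in_l2:
  assumes "V \<in> l2 \<L>" "F \<subseteq> evens"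
  shows "synth V F c \<in> l2 \<L>"
  unfolding l2_iff
proof (intro conjI allI impI)
  show "synth V F c x = 0" if "x \<notin> \<L>" for x
    unfolding synth_def transl_def
  proof (rule sum.neutral, rule ballI)
    fix a assume "a \<in> F"
    then have "x - a \<notin> \<L>" using that assms(2) Lam_diff_even_iff by blast
    then show "c a *s V (x - a) = 0" using assms(1) by (simp add: l2_iff)
  qed
  show "(\<lambda>x. (norm (synth V F c x))\<^sup>2) summable_on \<L>"
    using synth_parseval(1)[OF is_fourier_fourier[OF assms(1)] assms(2)] summable_on_def by blast
qed

lemma transl_in_l2:
  assumes "V \<in> l2 \<L>" "a \<in> evens"
  shows "transl a V \<in> l2 \<L>"
  using synth_in_l2[of V "{a}" "\<lambda>_. 1"] assms by (simp add: synth_def[abs_def])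

lemma modul_in_l2: "V \<in> l2 \<L> \<Longrightarrow> modul b V \<in> l2 \<L>"
  by (simp add: l2_iff modul_def norm_vector_smult)

lemma l2_norm_synth:
  assumes "V \<in> l2 \<L>" "F \<subseteq> evens"
  shows "(l2_norm \<L> (synth V F c))\<^sup>2
    = (\<integral>\<xi>. (cmod (psum c F \<xi>))\<^sup>2 * (norm (fourier \<L> (Omega N) V \<xi>))\<^sup>2 \<partial>\<mu>)"
  using synth_parseval(1)[OF is_fourier_fourier[OF assms(1)] assms(2)] l2_norm_power2[OF synth_in_l2[OF assms]]
  by (simp add: infsumI)

text \<open>The \<open>i\<close>-th power has frequency \<open>4 * N * i\<close>, which is
  \<open>2 * N\<close> times the even integer \<open>2 * i\<close>, a lattice point. So polynomials
  in this exponential are symbols of combinations of translates occurring in the Gabor system.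
  \<open>inv h\<close> recovers the degree from the frequency.\<close>

lemma poly_cis_eq_psum:
  "\<exists>F c. finite F \<and> F \<subseteq> (*) (2 * real N) ` evens \<and> (\<forall>\<xi>. poly Q (cis (2 * pi * (4 * real N) * \<xi>)) = psum c F \<xi>)"
proof -
  define h where "h i = 2 * real N * (2 * real_of_int (int i))" for i
  have inj: "inj h" using N unfolding h_def by (intro injI) simp
  have "poly Q (cis (2 * pi * (4 * real N) * \<xi>)) = psum (\<lambda>a. coeff Q (inv h a)) (h ` {..degree Q}) \<xi>" for \<xi>
  proof -
    have "psum (\<lambda>a. coeff Q (inv h a)) (h ` {..degree Q}) \<xi> = (\<Sum>i\<le>degree Q. coeff Q i * cis (2 * pi * h i * \<xi>))"
      unfolding psum_def by (subst sum.reindex) (use inj in \<open>auto simp: inj_on_def\<close>)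
    moreover have "cis (2 * pi * h i * \<xi>) = cis (2 * pi * (4 * real N) * \<xi>) ^ i" for i
      unfolding Complex.DeMoivre h_def by (simp add: algebra_simps)
    ultimately show ?thesis by (simp add: poly_altdef)
  qed
  moreover have "h ` {..degree Q} \<subseteq> (*) (2 * real N) ` evens"
    unfolding h_def by blast
  ultimately show ?thesis by (intro exI[of _ "h ` {..degree Q}"] exI[of _ "\<lambda>a. coeff Q (inv h a)"]) simp
qed

lemma evens_scaled_subset: "(*) (2 * real N) ` evens \<subseteq> evens"
proof
  fix a assume "a \<in> (*) (2 * real N) ` evens"
  then obtain n :: int where "a = 2 * real N * (2 * real_of_int n)" by blast
  then have "a = 2 * real_of_int (2 * int N * n)" by simp
  then show "a \<in> evens" by blast
qed

text \<open>Duality gives a synthesis bound. Parseval rewrites its left side as the integral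
  weighted by the squared norm of the transform, and its right side as the unweighted integral,
  since the shifts are themselves frequencies in the lattice. This is the polynomial test with
  \<open>q = 4 * N\<close> and \<open>R = N + 1\<close>.\<close>

lemma fourier_bounded_of_bessel:
  fixes V :: "real \<Rightarrow> complex^'s"
  assumes V: "V \<in> l2 \<L>" and "\<beta> > 0"
    and bessel: "\<And>F Z. finite F \<Longrightarrow> F \<subseteq> (*) (2 * real N) ` evens \<Longrightarrow> Z \<in> l2 \<L> \<Longrightarrow>
      (\<Sum>a\<in>F. (cmod (l2_inner \<L> Z (transl a V)))\<^sup>2) \<le> \<beta> * (l2_norm \<L> Z)\<^sup>2"
  shows "AE \<xi> in \<mu>. (norm (fourier \<L> (Omega N) V \<xi>))\<^sup>2
     \<le> \<beta> * card {k::int. \<bar>real_of_int k\<bar> \<le> 4 * real N * (real N + 1)}"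
proof (rule AE_bound_of_poly_test)
  show "Omega N \<in> lmeasurable" by (rule Omega_lmeasurable)
  show "integrable \<mu> (\<lambda>\<xi>. (norm (fourier \<L> (Omega N) V \<xi>))\<^sup>2)"
    by (rule is_fourier_norm_integrable[OF is_fourier_fourier[OF V]])
  show "Omega N \<subseteq> {0..real N + 1}" by (auto simp: Omega_def)
  fix Q :: "complex poly"
  obtain F c where F: "finite F" "F \<subseteq> (*) (2 * real N) ` evens"
    and Q: "\<And>\<xi>. poly Q (cis (2 * pi * (4 * real N) * \<xi>)) = psum c F \<xi>"
    using poly_cis_eq_psum[of Q] by blast
  have Fe: "F \<subseteq> evens" using F(2) evens_scaled_subset by blast
  have Y: "synth V F c \<in> l2 \<L>" by (rule synth_in_l2[OF V Fe])
  have "(l2_norm \<L> (synth V F c))\<^sup>2 \<le> \<beta> * (\<Sum>a\<in>F. (cmod (c a))\<^sup>2)"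
  proof (rule synthesis_bound_of_analysis_bound[where w = "\<lambda>a. transl a V"])
    show "synth V F c = (\<lambda>x. \<Sum>a\<in>F. c a *s transl a V x)" by (simp add: synth_def[abs_def])
  qed (use Y F Fe transl_in_l2[OF V] bessel[OF F Y] assms(2) in auto)
  also have "(\<Sum>a\<in>F. (cmod (c a))\<^sup>2) = (\<integral>\<xi>. (cmod (psum c F \<xi>))\<^sup>2 \<partial>\<mu>)"
    using F(1) Fe even_subset_Lam by (intro integral_psum_power2[symmetric]) blast+
  finally show "(\<integral>\<xi>. (cmod (poly Q (cis (2 * pi * (4 * real N) * \<xi>))))\<^sup>2 * (norm (fourier \<L> (Omega N) V \<xi>))\<^sup>2 \<partial>\<mu>)
     \<le> \<beta> * (\<integral>\<xi>. (cmod (poly Q (cis (2 * pi * (4 * real N) * \<xi>))))\<^sup>2 \<partial>\<mu>)"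
    unfolding Q l2_norm_synth[OF V Fe] .
qed (use N assms(2) in auto)

text \<open>On the Fourier side synthesis is multiplication by \<open>psum c F\<close>, so the
  pointwise bound \<open>B\<close> comes out of the integral and duality returns the analysis
  bound.\<close>

lemma bessel_of_fourier_bounded:
  fixes V :: "real \<Rightarrow> complex^'s"
  assumes V: "V \<in> l2 \<L>" and "B > 0" and F: "finite F" "F \<subseteq> evens" and Z: "Z \<in> l2 \<L>"
    and bound: "AE \<xi> in \<mu>. (norm (fourier \<L> (Omega N) V \<xi>))\<^sup>2 \<le> B"
  shows "(\<Sum>a\<in>F. (cmod (l2_inner \<L> Z (transl a V)))\<^sup>2) \<le> B * (l2_norm \<L> Z)\<^sup>2"
proof (rule analysis_bound_of_synthesis_bound[where w = "\<lambda>a. transl a V", OF Z _ assms(2)])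
  have eq: "(\<lambda>x. \<Sum>a\<in>F. c a *s transl a V x) = synth V F c" for c
    by (simp add: synth_def[abs_def])
  show "(\<lambda>x. \<Sum>a\<in>F. c a *s transl a V x) \<in> l2 \<L>" for c
    unfolding eq by (rule synth_in_l2[OF V F(2)])
  show "(l2_norm \<L> (\<lambda>x. \<Sum>a\<in>F. c a *s transl a V x))\<^sup>2 \<le> B * (\<Sum>a\<in>F. (cmod (c a))\<^sup>2)" for c
  proof -
    have "(l2_norm \<L> (synth V F c))\<^sup>2 \<le> (\<integral>\<xi>. B * (cmod (psum c F \<xi>))\<^sup>2 \<partial>\<mu>)"
      unfolding l2_norm_synth[OF V F(2)]
    proof (rule integral_mono_AE)
      show "AE \<xi> in \<mu>. (cmod (psum c F \<xi>))\<^sup>2 * (norm (fourier \<L> (Omega N) V \<xi>))\<^sup>2 \<le> B * (cmod (psum c F \<xi>))\<^sup>2"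
        using bound by eventually_elim (simp add: mult.commute mult_right_mono)
    qed (use synth_parseval(2)[OF is_fourier_fourier[OF V] F(2)] integrable_psum_power2 in auto)
    also have "\<dots> = B * (\<Sum>a\<in>F. (cmod (c a))\<^sup>2)"
      using F even_subset_Lam by (subst integral_mult_right_zero, subst integral_psum_power2) blast+
    finally show ?thesis unfolding eq .
  qed
qed (use F transl_in_l2[OF V] in auto)

section \<open>The Gabor system as translates of modulated windows\<close>

lemma double_N_Lam_subset_evens: "l \<in> \<L> \<Longrightarrow> 2 * real N * l \<in> evens"
proof -
  assume "l \<in> \<L>"
  then consider n :: int where "l = 2 * of_int n" | n :: int where "l = real r / real N + 2 * of_int n"
    unfolding Lam_def by auto
  then show ?thesis
  proof cases
    case (1 n)
    then have "2 * real N * l = 2 * real_of_int (2 * int N * n)" by simp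
    then show ?thesis by blast
  next
    case (2 n)
    then have "2 * real N * l = 2 * real_of_int (int r + 2 * int N * n)" using N by (simp add: field_simps)
    then show ?thesis by blast
  qed
qed

text \<open>Exchanging modulation by \<open>b\<close> and translation by \<open>a\<close> produces
  the constant phase \<open>cis (2 * pi * b * a)\<close>, which the modulus does not see.\<close>

lemma cmod_inner_DVNUG:
  assumes "Z \<in> l2 \<L>" "W j \<in> l2 \<L>" "l \<in> \<L>"
  shows "cmod (l2_inner \<L> Z (DVNUG N M W (m, j, l)))
    = cmod (l2_inner \<L> Z (transl (2 * real N * l) (modul (real m / real M) (W j))))"
proof -
  define b where "b = real m / real M"
  define a where "a = 2 * real N * l"
  have w: "transl a (modul b (W j)) \<in> l2 \<L>"
    unfolding a_def by (intro transl_in_l2 modul_in_l2 assms double_N_Lam_subset_evens)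
  \<comment> \<open>The sum over a singleton puts the phase in the form that
    \<open>l2_inner_sum_right\<close> handles.\<close>
  have "DVNUG N M W (m, j, l) x = (\<Sum>i\<in>{()}. cis (2 * pi * b * a) *s transl a (modul b (W j)) x)" for x
  proof -
    have "cis (2 * pi * b * x) = cis (2 * pi * b * a) * cis (2 * pi * b * (x - a))"
      unfolding cis_mult by (simp add: algebra_simps)
    then show ?thesis by (simp add: DVNUG_def modul_def transl_def a_def b_def)
  qed
  then have "DVNUG N M W (m, j, l) = (\<lambda>x. \<Sum>i\<in>{()}. cis (2 * pi * b * a) *s transl a (modul b (W j)) x)"
    by (rule ext)
  then have "l2_inner \<L> Z (DVNUG N M W (m, j, l)) = cnj (cis (2 * pi * b * a)) * l2_inner \<L> Z (transl a (modul b (W j)))"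
    using l2_inner_sum_right[OF assms(1), of "{()}" "\<lambda>_. transl a (modul b (W j))" "\<lambda>_. cis (2 * pi * b * a)"] w
    by simp
  then show ?thesis unfolding a_def b_def by (simp add: norm_mult)
qed

lemma DVNUG_bessel_iff:
  fixes W :: "nat \<Rightarrow> real \<Rightarrow> complex^'s"
  assumes W: "\<And>j. j \<in> T2 P \<Longrightarrow> W j \<in> l2 \<L>"
  shows "DVNUG_bessel N r M P W \<longleftrightarrow>
    (\<exists>C0::real. AE \<xi> in \<mu>. \<forall>m \<in> T1 M. \<forall>j \<in> T2 P.
       norm (fourier \<L> (Omega N) (modul (real m / real M) (W j)) \<xi>) \<le> C0)"
proof
  let ?I = "T1 M \<times> T2 P \<times> \<L>"
  assume "DVNUG_bessel N r M P W"
  then obtain \<beta> where "\<beta> > 0" and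
    summ: "\<And>Z. Z \<in> l2 \<L> \<Longrightarrow> (\<lambda>i. (cmod (l2_inner \<L> Z (DVNUG N M W i)))\<^sup>2) summable_on ?I" and
    le: "\<And>Z. Z \<in> l2 \<L> \<Longrightarrow> (\<Sum>\<^sub>\<infinity>i \<in> ?I. (cmod (l2_inner \<L> Z (DVNUG N M W i)))\<^sup>2) \<le> \<beta> * (l2_norm \<L> Z)\<^sup>2"
    unfolding DVNUG_bessel_def by blast
  define C where "C = \<beta> * card {k::int. \<bar>real_of_int k\<bar> \<le> 4 * real N * (real N + 1)}"
  have "AE \<xi> in \<mu>. norm (fourier \<L> (Omega N) (modul (real m / real M) (W j)) \<xi>) \<le> sqrt C"
    if mj: "m \<in> T1 M" "j \<in> T2 P" for m j
  proof -
    let ?V = "modul (real m / real M) (W j)"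
    have "AE \<xi> in \<mu>. (norm (fourier \<L> (Omega N) ?V \<xi>))\<^sup>2 \<le> C"
      unfolding C_def
    proof (rule fourier_bounded_of_bessel[OF modul_in_l2[OF W[OF mj(2)]] \<open>\<beta> > 0\<close>])
      fix F :: "real set" and Z :: "real \<Rightarrow> complex^'s"
      assume F: "finite F" "F \<subseteq> (*) (2 * real N) ` evens" and Z: "Z \<in> l2 \<L>"
      \<comment> \<open>Only the even lattice points \<open>l\<close> are tested; their multiples
        \<open>2 * N * l\<close> are the frequencies of polynomials in one exponential.\<close>
      define A where "A = {l \<in> evens. 2 * real N * l \<in> F}"
      have FA: "F = (*) (2 * real N) ` A" using F(2) unfolding A_def by blast
      have inj: "inj_on ((*) (2 * real N)) A" using N by (auto simp: inj_on_def)
      have "finite A" using F(1) inj FA finite_image_iff by blast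
      have AL: "A \<subseteq> \<L>" using even_subset_Lam unfolding A_def by blast
      have "(\<Sum>a\<in>F. (cmod (l2_inner \<L> Z (transl a ?V)))\<^sup>2) = (\<Sum>l\<in>A. (cmod (l2_inner \<L> Z (DVNUG N M W (m, j, l))))\<^sup>2)"
        unfolding FA sum.reindex[OF inj] comp_def
        using AL cmod_inner_DVNUG[where W = W and j = j, OF Z W[OF mj(2)]] by (intro sum.cong refl) (simp add: subset_iff)
      also have "\<dots> = (\<Sum>i\<in>{m} \<times> {j} \<times> A. (cmod (l2_inner \<L> Z (DVNUG N M W i)))\<^sup>2)"
        by (rule sum.reindex_bij_witness[of _ "\<lambda>(_, _, l). l" "\<lambda>l. (m, j, l)"]) auto
      also have "\<dots> \<le> (\<Sum>\<^sub>\<infinity>i \<in> ?I. (cmod (l2_inner \<L> Z (DVNUG N M W i)))\<^sup>2)"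
        using \<open>finite A\<close> AL mj by (intro finite_sum_le_infsum summ Z) auto
      also have "\<dots> \<le> \<beta> * (l2_norm \<L> Z)\<^sup>2" by (rule le[OF Z])
      finally show "(\<Sum>a\<in>F. (cmod (l2_inner \<L> Z (transl a ?V)))\<^sup>2) \<le> \<beta> * (l2_norm \<L> Z)\<^sup>2" .
    qed
    then show ?thesis by eventually_elim (rule real_le_rsqrt)
  qed
  \<comment> \<open>Finitely many pairs \<open>(m, j)\<close> share one exceptional null
    set.\<close>
  then have "AE \<xi> in \<mu>. \<forall>m \<in> T1 M. \<forall>j \<in> T2 P. norm (fourier \<L> (Omega N) (modul (real m / real M) (W j)) \<xi>) \<le> sqrt C"
    by (intro AE_finite_allI) (simp_all add: T1_def T2_def)
  then show "\<exists>C0::real. AE \<xi> in \<mu>. \<forall>m \<in> T1 M. \<forall>j \<in> T2 P.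
       norm (fourier \<L> (Omega N) (modul (real m / real M) (W j)) \<xi>) \<le> C0" by blast
next
  let ?I = "T1 M \<times> T2 P \<times> \<L>"
  assume "\<exists>C0::real. AE \<xi> in \<mu>. \<forall>m \<in> T1 M. \<forall>j \<in> T2 P.
       norm (fourier \<L> (Omega N) (modul (real m / real M) (W j)) \<xi>) \<le> C0"
  then obtain C0 where C0: "AE \<xi> in \<mu>. \<forall>m \<in> T1 M. \<forall>j \<in> T2 P.
       norm (fourier \<L> (Omega N) (modul (real m / real M) (W j)) \<xi>) \<le> C0" by blast
  \<comment> \<open>The added 1 keeps the bound positive when \<open>C0\<close> is 0.\<close>
  define B where "B = C0\<^sup>2 + 1"
  have "B > 0" unfolding B_def by (simp add: add_nonneg_pos)
  \<comment> \<open>One copy of \<open>B\<close> for each pair \<open>(m, j)\<close>; the added 1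
    gives positivity even if there is no pair.\<close>
  define \<beta> where "\<beta> = card (T1 M \<times> T2 P) * B + 1"
  have "\<beta> > 0" unfolding \<beta>_def using \<open>B > 0\<close> by (simp add: add_nonneg_pos)
  have fin: "finite (T1 M)" "finite (T2 P)" by (simp_all add: T1_def T2_def)
  have sum_le: "(\<Sum>i\<in>I. (cmod (l2_inner \<L> Z (DVNUG N M W i)))\<^sup>2) \<le> \<beta> * (l2_norm \<L> Z)\<^sup>2"
    if Z: "Z \<in> l2 \<L>" and I: "finite I" "I \<subseteq> ?I" for Z I
  proof -
    \<comment> \<open>Projecting \<open>I\<close> to its lattice coordinate encloses it in a finite
      product, over which the sum splits into one sum per pair \<open>(m, j)\<close>.\<close>
    define A where "A = (\<lambda>(_, _, l). l) ` I"
    have A: "finite A" "A \<subseteq> \<L>" "I \<subseteq> T1 M \<times> T2 P \<times> A" using I unfolding A_def by force+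
    have inj: "inj_on ((*) (2 * real N)) A" using N by (auto simp: inj_on_def)
    have mj_le: "(\<Sum>l\<in>A. (cmod (l2_inner \<L> Z (DVNUG N M W (m, j, l))))\<^sup>2) \<le> B * (l2_norm \<L> Z)\<^sup>2"
      if mj: "m \<in> T1 M" "j \<in> T2 P" for m j
    proof -
      let ?V = "modul (real m / real M) (W j)"
      have "(\<Sum>l\<in>A. (cmod (l2_inner \<L> Z (DVNUG N M W (m, j, l))))\<^sup>2)
          = (\<Sum>a\<in>(*) (2 * real N) ` A. (cmod (l2_inner \<L> Z (transl a ?V)))\<^sup>2)"
        unfolding sum.reindex[OF inj] comp_def
        using A(2) cmod_inner_DVNUG[where W = W and j = j, OF Z W[OF mj(2)]] by (intro sum.cong refl) (simp add: subset_iff)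
      also have "\<dots> \<le> B * (l2_norm \<L> Z)\<^sup>2"
      proof (rule bessel_of_fourier_bounded[OF modul_in_l2[OF W[OF mj(2)]] \<open>B > 0\<close> _ _ Z])
        show "(*) (2 * real N) ` A \<subseteq> evens" using A(2) double_N_Lam_subset_evens by blast
        show "AE \<xi> in \<mu>. (norm (fourier \<L> (Omega N) ?V \<xi>))\<^sup>2 \<le> B"
          using C0
        proof eventually_elim
          case (elim \<xi>)
          then have "norm (fourier \<L> (Omega N) ?V \<xi>) \<le> C0" using mj by blast
          then have "(norm (fourier \<L> (Omega N) ?V \<xi>))\<^sup>2 \<le> C0\<^sup>2" by (rule power_mono) simp
          then show ?case by (simp add: B_def)
        qed
      qed (use A(1) in simp)
      finally show ?thesis .
    qed
    have "(\<Sum>i\<in>I. (cmod (l2_inner \<L> Z (DVNUG N M W i)))\<^sup>2)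
        \<le> (\<Sum>i\<in>T1 M \<times> T2 P \<times> A. (cmod (l2_inner \<L> Z (DVNUG N M W i)))\<^sup>2)"
      using A fin by (intro sum_mono2) auto
    also have "\<dots> = (\<Sum>m\<in>T1 M. \<Sum>j\<in>T2 P. \<Sum>l\<in>A. (cmod (l2_inner \<L> Z (DVNUG N M W (m, j, l))))\<^sup>2)"
      by (simp add: sum.cartesian_product)
    also have "\<dots> \<le> (\<Sum>m\<in>T1 M. \<Sum>j\<in>T2 P. B * (l2_norm \<L> Z)\<^sup>2)"
      by (intro sum_mono mj_le)
    also have "\<dots> \<le> \<beta> * (l2_norm \<L> Z)\<^sup>2"
      unfolding \<beta>_def by (simp add: card_cartesian_product algebra_simps)
    finally show ?thesis .
  qed
  have "(\<lambda>i. (cmod (l2_inner \<L> Z (DVNUG N M W i)))\<^sup>2) summable_on ?I" if "Z \<in> l2 \<L>" for Z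
    using sum_le[OF that] by (intro nonneg_bdd_above_summable_on bdd_aboveI[of _ "\<beta> * (l2_norm \<L> Z)\<^sup>2"]) auto
  with \<open>\<beta> > 0\<close> sum_le show "DVNUG_bessel N r M P W"
    unfolding DVNUG_bessel_def by (intro exI[of _ \<beta>]) (auto intro: infsum_le_finite_sums)
qed

end

theorem corollary3p6:
  fixes N M P r :: nat and W :: "nat \<Rightarrow> real \<Rightarrow> complex^'s"
  assumes "N \<ge> 1" and "M \<ge> 1"
    and "odd r" and "coprime r N" and "1 \<le> r" and "r \<le> 2 * N - 1"
    and "\<forall>j \<in> T2 P. W j \<in> l2 (Lam N r)"
  shows "DVNUG_bessel N r M P W \<longleftrightarrow>
    (\<exists>C0::real. AE \<xi> in lebesgue_on (Omega N). \<forall>m \<in> T1 M. \<forall>j \<in> T2 P.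
       norm (fourier (Lam N r) (Omega N) (modul (real m / real M) (W j)) \<xi>) \<le> C0)"
proof -
  interpret nonuniform_lattice N r by unfold_locales fact+
  show ?thesis by (rule DVNUG_bessel_iff) (use assms in blast)
qed

end
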